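(* Let $X,Y,A,B$ be second countable compact Hausdorff spaces, $H$ a Hilbert space, and let $\mu$ and $\nu$ be continuous (that is, non-atomic) Borel probability measures on $X$ and $Y$, respectively. Let $E$ be a $\mathcal{B}(H)$-valued $\mu$-information channel from $X$ to $A$ and $F$ a $\mathcal{B}(H)$-valued $\nu$-information channel from $Y$ to $B$, and assume that $E$ and $F$ have commuting ranges. Then there exist a Hilbert space $K$, an isometry $V:H\to K$, a $\mathcal{B}(K)$-valued $\mu$-information channel $P$ from $X$ to $A$ and a $\mathcal{B}(K)$-valued $\nu$-information channel $Q$ from $Y$ to $B$, which have commuting ranges and whose values are projections, such that $$E(\alpha|x)F(\beta|y)=V^*P(\alpha|x)Q(\beta|y)V,\qquad \alpha\in\mathfrak{A}_A,\ \beta\in\mathfrak{A}_B,\ x\in X,\ y\in Y.$$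
   Context: $\mathfrak{A}_A$ denotes the Borel $\sigma$-algebra of $A$. A quantum probability measure (QPM) on a compact Hausdorff space $A$ with values in $\mathcal{B}(H)$ is a map $E:\mathfrak{A}_A\to\mathcal{B}(H)^+$ with $E(A)=I_H$ that is countably additive on disjoint sequences of Borel sets in the weak* topology. Given a Borel probability measure $\mu$ on $X$, a $\mathcal{B}(H)$-valued $\mu$-information channel from $X$ to $A$ (over $(X,A)$) is a family $(E(\cdot|x))_{x\in X}$ of QPM's on $A$ with values in $\mathcal{B}(H)$ such that for every $\alpha\in\mathfrak{A}_A$ and all $\xi,\eta\in H$ the function $x\mapsto\langle E(\alpha|x)\xi,\eta\rangle$ is measurable with respect to the $\mu$-completion of the Borel $\sigma$-algebra of $X$. $E$ and $F$ have commuting ranges if $E(\alpha|x)F(\beta|y)=F(\beta|y)E(\alpha|x)$ for all $x,y,\alpha,\beta$. *)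

theory Defs
  imports
    "HOL-Probability.Probability_Measure"
    "HOL-Algebra.Algebraic_Closure_Type"
    "HOL-Library.Nonpos_Ints"
begin

section \<open>Complex Hilbert spaces\<close>

text \<open>
  Hilbert spaces have explicit carriers, so that a Hilbert space can be quantified existentially.
  The multiplication and unit fields that the module record inherits from the ring record
  play no role.
\<close>

record 'v hilbert = "(complex, 'v) module" +
  hinner :: "'v \<Rightarrow> 'v \<Rightarrow> complex"

definition hnorm :: "'v hilbert \<Rightarrow> 'v \<Rightarrow> real" where
  "hnorm H \<xi> = sqrt (Re (hinner H \<xi> \<xi>))"

text \<open>The inner product is linear in its first argument.\<close>

locale hilbert_space = module "ring_of_type_algebra :: complex ring" H
  for H :: "'v hilbert" (structure) +
  assumes hinner_add_left:
      "\<lbrakk>\<xi> \<in> carrier H; \<eta> \<in> carrier H; \<zeta> \<in> carrier H\<rbrakk>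
        \<Longrightarrow> hinner H (\<xi> \<oplus> \<eta>) \<zeta> = hinner H \<xi> \<zeta> + hinner H \<eta> \<zeta>"
    and hinner_smult_left:
      "\<lbrakk>\<xi> \<in> carrier H; \<eta> \<in> carrier H\<rbrakk> \<Longrightarrow> hinner H (c \<odot> \<xi>) \<eta> = c * hinner H \<xi> \<eta>"
    and hinner_commute:
      "\<lbrakk>\<xi> \<in> carrier H; \<eta> \<in> carrier H\<rbrakk> \<Longrightarrow> hinner H \<xi> \<eta> = cnj (hinner H \<eta> \<xi>)"
    and hinner_nonneg:
      "\<xi> \<in> carrier H \<Longrightarrow> hinner H \<xi> \<xi> \<in> \<real>\<^sub>\<ge>\<^sub>0"
    and hinner_eq_zero_iff:
      "\<xi> \<in> carrier H \<Longrightarrow> hinner H \<xi> \<xi> = 0 \<longleftrightarrow> \<xi> = \<zero>"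
    and complete:
      "Metric_space.mcomplete (carrier H) (\<lambda>\<xi> \<eta>. hnorm H (\<xi> \<ominus> \<eta>))"


section \<open>Operators\<close>

text \<open>
  Operators are functions on the whole type of which only the values on the carrier matter;
  accordingly, equality of operators always means equality on the carrier.
\<close>

definition bounded_op :: "'v hilbert \<Rightarrow> 'w hilbert \<Rightarrow> ('v \<Rightarrow> 'w) \<Rightarrow> bool" where
  "bounded_op H K T \<longleftrightarrow>
     T \<in> carrier H \<rightarrow> carrier K \<and>
     (\<forall>\<xi>\<in>carrier H. \<forall>\<eta>\<in>carrier H. T (\<xi> \<oplus>\<^bsub>H\<^esub> \<eta>) = T \<xi> \<oplus>\<^bsub>K\<^esub> T \<eta>) \<and>
     (\<forall>c. \<forall>\<xi>\<in>carrier H. T (c \<odot>\<^bsub>H\<^esub> \<xi>) = c \<odot>\<^bsub>K\<^esub> T \<xi>) \<and>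
     (\<exists>C. \<forall>\<xi>\<in>carrier H. hnorm K (T \<xi>) \<le> C * hnorm H \<xi>)"

definition isometry_op :: "'v hilbert \<Rightarrow> 'w hilbert \<Rightarrow> ('v \<Rightarrow> 'w) \<Rightarrow> bool" where
  "isometry_op H K V \<longleftrightarrow>
     bounded_op H K V \<and> (\<forall>\<xi>\<in>carrier H. hnorm K (V \<xi>) = hnorm H \<xi>)"

definition adjoint_op :: "'v hilbert \<Rightarrow> 'w hilbert \<Rightarrow> ('v \<Rightarrow> 'w) \<Rightarrow> 'w \<Rightarrow> 'v" where
  "adjoint_op H K T \<zeta> =
     (THE \<xi>. \<xi> \<in> carrier H \<and> (\<forall>\<eta>\<in>carrier H. hinner H \<xi> \<eta> = hinner K \<zeta> (T \<eta>)))"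

definition positive_op :: "'v hilbert \<Rightarrow> ('v \<Rightarrow> 'v) \<Rightarrow> bool" where
  "positive_op H T \<longleftrightarrow>
     bounded_op H H T \<and> (\<forall>\<xi>\<in>carrier H. hinner H (T \<xi>) \<xi> \<in> \<real>\<^sub>\<ge>\<^sub>0)"

definition projection_op :: "'v hilbert \<Rightarrow> ('v \<Rightarrow> 'v) \<Rightarrow> bool" where
  "projection_op H T \<longleftrightarrow>
     bounded_op H H T \<and>
     (\<forall>\<xi>\<in>carrier H. T (T \<xi>) = T \<xi>) \<and>
     (\<forall>\<xi>\<in>carrier H. \<forall>\<eta>\<in>carrier H. hinner H (T \<xi>) \<eta> = hinner H \<xi> (T \<eta>))"

text \<open>
  The weak* continuous functionals on the bounded operators are the maps
  \<open>T \<mapsto> \<Sum>n. \<langle>T \<xi>\<^sub>n, \<eta>\<^sub>n\<rangle>\<close> for square summable sequences of vectors. A series of operators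
  converges in the weak* topology iff every such functional maps it to a convergent series with
  the corresponding sum.
\<close>

definition square_summable :: "'v hilbert \<Rightarrow> (nat \<Rightarrow> 'v) \<Rightarrow> bool" where
  "square_summable H \<xi> \<longleftrightarrow>
     range \<xi> \<subseteq> carrier H \<and> summable (\<lambda>n. (hnorm H (\<xi> n))\<^sup>2)"

definition weak_star_sums :: "'v hilbert \<Rightarrow> (nat \<Rightarrow> 'v \<Rightarrow> 'v) \<Rightarrow> ('v \<Rightarrow> 'v) \<Rightarrow> bool" where
  "weak_star_sums H S T \<longleftrightarrow>
     (\<forall>\<xi> \<eta>. square_summable H \<xi> \<and> square_summable H \<eta> \<longrightarrow>
        (\<lambda>i. \<Sum>n. hinner H (S i (\<xi> n)) (\<eta> n)) sums (\<Sum>n. hinner H (T (\<xi> n)) (\<eta> n)))"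


section \<open>Quantum probability measures and information channels\<close>

definition qpm :: "'v hilbert \<Rightarrow> ('a::topological_space set \<Rightarrow> 'v \<Rightarrow> 'v) \<Rightarrow> bool" where
  "qpm H E \<longleftrightarrow>
     (\<forall>\<alpha>\<in>sets borel. positive_op H (E \<alpha>)) \<and>
     (\<forall>\<xi>\<in>carrier H. E UNIV \<xi> = \<xi>) \<and>
     (\<forall>\<alpha>::nat \<Rightarrow> 'a set. range \<alpha> \<subseteq> sets borel \<and> disjoint_family \<alpha> \<longrightarrow>
        weak_star_sums H (\<lambda>i. E (\<alpha> i)) (E (\<Union>i. \<alpha> i)))"

definition information_channel ::
  "'v hilbert \<Rightarrow> 'x::topological_space measure \<Rightarrow>
     ('x \<Rightarrow> 'a::topological_space set \<Rightarrow> 'v \<Rightarrow> 'v) \<Rightarrow> bool" where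
  "information_channel H \<mu> E \<longleftrightarrow>
     (\<forall>x. qpm H (E x)) \<and>
     (\<forall>\<alpha>\<in>sets borel. \<forall>\<xi>\<in>carrier H. \<forall>\<eta>\<in>carrier H.
        (\<lambda>x. hinner H (E x \<alpha> \<xi>) \<eta>) \<in> borel_measurable (completion \<mu>))"

definition commuting_ranges ::
  "'v hilbert \<Rightarrow> ('x \<Rightarrow> 'a::topological_space set \<Rightarrow> 'v \<Rightarrow> 'v) \<Rightarrow>
     ('y \<Rightarrow> 'b::topological_space set \<Rightarrow> 'v \<Rightarrow> 'v) \<Rightarrow> bool" where
  "commuting_ranges H E F \<longleftrightarrow>
     (\<forall>x y. \<forall>\<alpha>\<in>sets borel. \<forall>\<beta>\<in>sets borel. \<forall>\<xi>\<in>carrier H.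
        E x \<alpha> (F y \<beta> \<xi>) = F y \<beta> (E x \<alpha> \<xi>))"

definition projection_valued ::
  "'v hilbert \<Rightarrow> ('x \<Rightarrow> 'a::topological_space set \<Rightarrow> 'v \<Rightarrow> 'v) \<Rightarrow> bool" where
  "projection_valued H E \<longleftrightarrow> (\<forall>x. \<forall>\<alpha>\<in>sets borel. projection_op H (E x \<alpha>))"

definition borel_probability :: "'x::topological_space measure \<Rightarrow> bool" where
  "borel_probability \<mu> \<longleftrightarrow> prob_space \<mu> \<and> sets \<mu> = sets borel"

definition nonatomic :: "'x measure \<Rightarrow> bool" where
  "nonatomic \<mu> \<longleftrightarrow>
     (\<forall>\<alpha>\<in>sets \<mu>. 0 < emeasure \<mu> \<alpha> \<longrightarrow>
        (\<exists>\<beta>\<in>sets \<mu>. \<beta> \<subseteq> \<alpha> \<and> 0 < emeasure \<mu> \<beta> \<and> emeasure \<mu> \<beta> < emeasure \<mu> \<alpha>))"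

text \<open>
  A type large enough to carry the dilation space. If \<open>V\<close> maps into a Hilbert space \<open>K\<close> on which
  channels \<open>P\<close> and \<open>Q\<close> act, and \<open>K\<close> is the closed linear span of the vectors \<open>w V \<eta>\<close> with \<open>w\<close> a word
  in the operators \<open>P(\<alpha>|x)\<close> and \<open>Q(\<beta>|y)\<close>, then sending \<open>\<zeta>\<close> to the function
  \<open>(w, \<eta>) \<mapsto> \<langle>\<zeta>, w V \<eta>\<rangle>\<close> is injective; hence every such \<open>K\<close> is isomorphic to a Hilbert space
  whose carrier is a set of functions of this type.
\<close>

type_synonym ('x, 'a, 'y, 'b, 'h) dilation_vector =
  "('x \<times> 'a set + 'y \<times> 'b set) list \<times> 'h \<Rightarrow> complex"

end

(*
  For a single input x let N_x be the orthogonal complement of H in the space of the Naimark dilation of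
  E(.|x). All these dilations can be combined on the direct sum of H and all N_x: on H + N_x the measure
  P(.|x) is the Naimark dilation, and on every other summand it is the point mass at a fixed point of A.
  Operators that commute with E act diagonally, so that the construction can be repeated for F.

  Vectors P(alpha|x) Q(beta|y) V eta span the resulting space, and their inner products form an explicit
  positive definite kernel, namely the product of the operator kernels of E and F. Hence the space is
  obtained at one stroke as a reproducing kernel Hilbert space, on which P and Q act by substitution.
  A matrix coefficient of P(alpha|x) between two spanning vectors is, for all but two inputs x,
  affine in a matrix coefficient of E(alpha|x); this yields the measurability.
*)

theory Submission
  imports Defs
begin

text \<open>Two letters per word suffice because the span of the vectors P(\<alpha>'|x') Q V \<eta>
  is already invariant: for x different from x', such a vector splits into Q V E(\<alpha>'|x')
  \<eta> and a remainder in the summand of x'. P(\<alpha>|x) gives the first part a new letter and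
  multiplies the second by 0 or 1.

  The dilations for different inputs meet only in H. Hence the kernel of E is a product
  E(\<alpha>'|x') E(\<alpha>|x) off the diagonal, and its positivity splits into a part coming from
  H and one block for each input. Multiplying by the kernel of F keeps positivity because the two
  commute; a series of squares takes the place of an operator square root.

  The space may be nonseparable. Measurability survives because every single vector is the limit of
  a sequence of finite combinations, each of which involves only finitely many inputs.

  E and F are treated by one construction, which has an arbitrary positive operator kernel commuting
  with the channel as a parameter. It is instantiated twice, and since the kernels commute, both
  instances live on the same space.\<close>

section \<open>Reproducing kernel Hilbert spaces\<close>

text \<open>By the reproducing property this is the inner product of \<open>f\<close> with the
  combination that has coefficient list \<open>v\<close>, hence the conjugates. It makes sense for
  every function, also outside the Hilbert space.\<close>

definition ev :: "('s \<Rightarrow> complex) \<Rightarrow> (complex \<times> 's) list \<Rightarrow> complex" where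
  "ev f v = (\<Sum>(d, t)\<leftarrow>v. cnj d * f t)"

definition lin_comb :: "('s \<Rightarrow> 's \<Rightarrow> complex) \<Rightarrow> (complex \<times> 's) list \<Rightarrow> 's \<Rightarrow> complex" where
  "lin_comb k u t = (\<Sum>(c, s)\<leftarrow>u. c * k s t)"

definition scale :: "complex \<Rightarrow> (complex \<times> 's) list \<Rightarrow> (complex \<times> 's) list" where
  "scale c u = map (\<lambda>(d, s). (c * d, s)) u"

definition kform :: "('s \<Rightarrow> 's \<Rightarrow> complex) \<Rightarrow> (complex \<times> 's) list \<Rightarrow> (complex \<times> 's) list \<Rightarrow> complex" where
  "kform k u v = ev (lin_comb k u) v"

definition knorm :: "('s \<Rightarrow> 's \<Rightarrow> complex) \<Rightarrow> (complex \<times> 's) list \<Rightarrow> real" where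
  "knorm k u = sqrt (Re (kform k u u))"

lemma ev_Nil [simp]: "ev f [] = 0"
  by (simp add: ev_def)

lemma ev_Cons [simp]: "ev f ((d, t) # v) = cnj d * f t + ev f v"
  by (simp add: ev_def)

lemma ev_append [simp]: "ev f (u @ v) = ev f u + ev f v"
  by (simp add: ev_def)

lemma ev_scale [simp]: "ev f (scale c v) = cnj c * ev f v"
  by (induction v) (auto simp: scale_def algebra_simps)

lemma ev_add: "ev (\<lambda>t. f t + g t) v = ev f v + ev g v"
  by (induction v) (auto simp: algebra_simps)

lemma ev_diff: "ev (\<lambda>t. f t - g t) v = ev f v - ev g v"
  by (induction v) (auto simp: algebra_simps)

lemma ev_smult: "ev (\<lambda>t. c * f t) v = c * ev f v"
  by (induction v) (auto simp: algebra_simps)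

lemma ev_zero [simp]: "ev (\<lambda>t. 0) v = 0"
  by (induction v) auto

lemma lin_comb_Nil [simp]: "lin_comb k [] = (\<lambda>t. 0)"
  by (simp add: lin_comb_def fun_eq_iff)

lemma lin_comb_Cons [simp]: "lin_comb k ((c, s) # u) = (\<lambda>t. c * k s t + lin_comb k u t)"
  by (simp add: lin_comb_def fun_eq_iff)

lemma lin_comb_append: "lin_comb k (u @ v) = (\<lambda>t. lin_comb k u t + lin_comb k v t)"
  by (simp add: lin_comb_def fun_eq_iff)

lemma lin_comb_scale: "lin_comb k (scale c u) = (\<lambda>t. c * lin_comb k u t)"
  by (induction u) (auto simp: scale_def algebra_simps)

lemma kform_append_left: "kform k (u @ v) w = kform k u w + kform k v w"
  by (simp add: kform_def lin_comb_append ev_add)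

lemma kform_append_right: "kform k u (v @ w) = kform k u v + kform k u w"
  by (simp add: kform_def)

lemma kform_scale_left: "kform k (scale c u) w = c * kform k u w"
  by (simp add: kform_def lin_comb_scale ev_smult)

lemma kform_scale_right: "kform k u (scale c w) = cnj c * kform k u w"
  by (simp add: kform_def)

lemma tendsto_ev:
  assumes "\<And>t. (\<lambda>n. f n t) \<longlonglongrightarrow> g t"
  shows "(\<lambda>n. ev (f n) v) \<longlonglongrightarrow> ev g v"
  by (induction v) (auto intro!: tendsto_intros assms)

text \<open>The form is tested only at \<open>z = - t * cnj b\<close> with real t. Stated for plain
  numbers, it serves both the kernel form and the inner product of \<open>H\<close>.\<close>

lemma semi_inner_Cauchy_Schwarz:
  fixes b :: complex
  assumes a: "0 \<le> a" and c: "0 \<le> c" and nonneg: "\<And>z. 0 \<le> a + 2 * Re (z * b) + (cmod z)\<^sup>2 * c"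
  shows "(cmod b)\<^sup>2 \<le> a * c"
proof -
  have q: "0 \<le> a - 2 * t * (cmod b)\<^sup>2 + t\<^sup>2 * (cmod b)\<^sup>2 * c" for t :: real
  proof -
    have "Re ((- of_real t * cnj b) * b) = - t * (cmod b)\<^sup>2"
      by (simp add: cmod_power2) (simp add: algebra_simps power2_eq_square)
    with nonneg[of "- of_real t * cnj b"] show ?thesis
      by (simp add: norm_mult power_mult_distrib)
  qed
  show ?thesis
  proof (cases "c = 0")
    case True
    show ?thesis
    proof (rule ccontr)
      assume "\<not> ?thesis"
      hence "(cmod b)\<^sup>2 > 0" using True by simp
      \<comment> \<open>With c = 0 the polynomial is affine in t; at this t its value is - a -
        2.\<close>
      with q[of "(a + 1) / (cmod b)\<^sup>2"] True a show False by (simp add: field_simps)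
    qed
  next
    case False
    hence "c > 0" using c by simp
    \<comment> \<open>t = 1 / c minimises the polynomial.\<close>
    with q[of "1 / c"] show ?thesis
      by (simp add: field_simps power2_eq_square)
  qed
qed

lemma Re_of_real_mult: "Re (of_real r * w) = r * Re w"
  by simp

section \<open>The seminorm of a positive semidefinite kernel and its dual norm\<close>

locale psd_kernel =
  fixes k :: "'s \<Rightarrow> 's \<Rightarrow> complex"
  assumes hermitian: "k t s = cnj (k s t)"
    and kform_nonneg: "0 \<le> Re (kform k u u)"
begin

abbreviation "comb \<equiv> lin_comb k"
abbreviation "B \<equiv> kform k"
abbreviation "N \<equiv> knorm k"

definition diff :: "(complex \<times> 's) list \<Rightarrow> (complex \<times> 's) list \<Rightarrow> (complex \<times> 's) list" where
  "diff u v = u @ scale (-1) v"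

lemma comb_diff: "comb (diff u v) = (\<lambda>t. comb u t - comb v t)"
  by (simp add: diff_def lin_comb_append lin_comb_scale)

lemma ev_list_diff [simp]: "ev f (diff u v) = ev f u - ev f v"
  by (simp add: diff_def)

lemma ev_kernel: "ev (k s) v = cnj (comb v s)"
proof (induction v)
  case (Cons p v)
  have "k s (snd p) = cnj (k (snd p) s)" by (rule hermitian)
  with Cons show ?case by (cases p) simp
qed simp

lemma kform_commute: "B u v = cnj (B v u)"
proof (induction u)
  case Nil
  show ?case by (simp add: kform_def)
next
  case (Cons p u)
  obtain c s where "p = (c, s)" by fastforce
  with Cons show ?case
    by (simp add: kform_def ev_add ev_smult ev_kernel)
qed

lemma N_nonneg [simp]: "0 \<le> N u"
  by (simp add: knorm_def kform_nonneg)

lemma N_square: "(N u)\<^sup>2 = Re (B u u)"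
  by (simp add: knorm_def kform_nonneg)

lemma Cauchy_Schwarz: "cmod (B u v) \<le> N u * N v"
proof (rule power2_le_imp_le)
  have "(cmod (B v u))\<^sup>2 \<le> Re (B u u) * Re (B v v)"
  proof (rule semi_inner_Cauchy_Schwarz)
    fix z
    have "Re (B (u @ scale z v) (u @ scale z v))
      = Re (B u u) + Re (cnj z * B u v + z * B v u) + Re (z * cnj z * B v v)"
      by (simp add: kform_append_left kform_append_right kform_scale_left kform_scale_right algebra_simps)
    also have "Re (cnj z * B u v + z * B v u) = 2 * Re (z * B v u)"
      by (subst kform_commute[of u v]) simp
    also have "Re (z * cnj z * B v v) = (cmod z)\<^sup>2 * Re (B v v)"
      by (simp only: complex_norm_square[symmetric] Re_of_real_mult)
    finally show "0 \<le> Re (B u u) + 2 * Re (z * B v u) + (cmod z)\<^sup>2 * Re (B v v)"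
      using kform_nonneg by metis
  qed (rule kform_nonneg)+
  moreover have "cmod (B v u) = cmod (B u v)"
    by (subst kform_commute) simp
  ultimately show "(cmod (B u v))\<^sup>2 \<le> (N u * N v)\<^sup>2"
    by (simp add: power_mult_distrib N_square)
qed simp

text \<open>
  The Hilbert space is the closure of the span of the kernel functions in the dual norm of \<open>N\<close>, which makes
  sense for arbitrary functions; so no quotient of Cauchy sequences is needed.
\<close>

definition bounded_by :: "('s \<Rightarrow> complex) \<Rightarrow> real \<Rightarrow> bool" where
  "bounded_by f c \<longleftrightarrow> (\<forall>v. cmod (ev f v) \<le> c * N v)"

lemma bounded_byD: "bounded_by f c \<Longrightarrow> cmod (ev f v) \<le> c * N v"
  by (simp add: bounded_by_def)

lemma bounded_by_comb: "bounded_by (comb u) (N u)"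
  using Cauchy_Schwarz by (simp add: bounded_by_def kform_def)

text \<open>Testing the bound on \<open>u\<close> itself gives \<open>(N u)^2 \<le> c * N u\<close>.
  With \<open>bounded_by_comb\<close>, the dual norm of \<open>comb u\<close> is therefore exactly
  \<open>N u\<close>.\<close>

lemma N_le:
  assumes "bounded_by (comb u) c" "0 \<le> c"
  shows "N u \<le> c"
proof -
  have "(N u)\<^sup>2 \<le> c * N u"
    using bounded_byD[OF assms(1), of u] complex_Re_le_cmod[of "B u u"]
    by (simp add: N_square kform_def)
  thus ?thesis
    using assms(2) N_nonneg[of u] by (cases "N u = 0") (auto simp: power2_eq_square)
qed

lemma bounded_by_add:
  assumes "bounded_by f c" "bounded_by g d"
  shows "bounded_by (\<lambda>t. f t + g t) (c + d)"
  unfolding bounded_by_def ev_add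
  using bounded_byD[OF assms(1)] bounded_byD[OF assms(2)]
  by (auto simp: distrib_right intro: order_trans[OF norm_triangle_ineq] add_mono)

lemma bounded_by_smult:
  assumes "bounded_by f c"
  shows "bounded_by (\<lambda>t. a * f t) (cmod a * c)"
  using assms by (auto simp: bounded_by_def ev_smult norm_mult mult.assoc intro: mult_left_mono)

lemma bounded_by_minus: "bounded_by (\<lambda>t. f t - g t) c \<Longrightarrow> bounded_by (\<lambda>t. g t - f t) c"
  using bounded_by_smult[of "\<lambda>t. f t - g t" c "-1"] by simp

lemma bounded_by_diff_trans:
  assumes "bounded_by (\<lambda>t. f t - g t) c" "bounded_by (\<lambda>t. g t - h t) d"
  shows "bounded_by (\<lambda>t. f t - h t) (c + d)"
  using bounded_by_add[OF assms] by simp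

lemma bounded_by_point:
  assumes "bounded_by f c"
  shows "cmod (f t) \<le> c * N [(1, t)]"
  using bounded_byD[OF assms, of "[(1, t)]"] by simp

lemma N_diff_le:
  assumes "bounded_by (\<lambda>t. g t - comb u t) a" "bounded_by (\<lambda>t. g t - comb v t) b" "0 \<le> a" "0 \<le> b"
  shows "N (diff u v) \<le> a + b"
  using bounded_by_diff_trans[OF bounded_by_minus[OF assms(1)] assms(2)] assms(3,4)
  by (intro N_le) (auto simp: comb_diff)

section \<open>Limits of kernel combinations and their inner product\<close>

text \<open>An explicit error sequence stands in for the norm, which is available only after
  \<open>ip\<close>. Its nonnegativity is required separately because \<open>bounded_by\<close> does
  not force it where \<open>N\<close> vanishes identically.\<close>

definition approx :: "(nat \<Rightarrow> (complex \<times> 's) list) \<Rightarrow> ('s \<Rightarrow> complex) \<Rightarrow> bool" where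
  "approx u f \<longleftrightarrow> (\<exists>e. e \<longlonglongrightarrow> 0 \<and> (\<forall>n. 0 \<le> e n \<and> bounded_by (\<lambda>t. f t - comb (u n) t) (e n)))"

definition kspace :: "('s \<Rightarrow> complex) set" where
  "kspace = {f. \<forall>e>0. \<exists>u. bounded_by (\<lambda>t. f t - comb u t) e}"

text \<open>The inner product is extended by continuity along an arbitrarily chosen approximating
  sequence; \<open>ip_lim\<close> removes the dependence on the choice.\<close>

definition ip :: "('s \<Rightarrow> complex) \<Rightarrow> ('s \<Rightarrow> complex) \<Rightarrow> complex" where
  "ip f g = lim (\<lambda>n. ev f ((SOME v. approx v g) n))"

lemma bounded_by_zero: "bounded_by (\<lambda>t. 0) 0"
  by (simp add: bounded_by_def)

lemma approx_comb: "approx (\<lambda>n. u) (comb u)"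
  unfolding approx_def by (rule exI[of _ "\<lambda>n. 0"]) (simp add: bounded_by_zero)

lemma approx_add:
  assumes "approx u f" "approx v g"
  shows "approx (\<lambda>n. u n @ v n) (\<lambda>t. f t + g t)"
proof -
  obtain d where d: "d \<longlonglongrightarrow> 0" "\<And>n. 0 \<le> d n" "\<And>n. bounded_by (\<lambda>t. f t - comb (u n) t) (d n)"
    using assms(1) unfolding approx_def by blast
  obtain e where e: "e \<longlonglongrightarrow> 0" "\<And>n. 0 \<le> e n" "\<And>n. bounded_by (\<lambda>t. g t - comb (v n) t) (e n)"
    using assms(2) unfolding approx_def by blast
  have "bounded_by (\<lambda>t. f t + g t - comb (u n @ v n) t) (d n + e n)" for n
    using bounded_by_add[OF d(3) e(3)] by (simp add: lin_comb_append algebra_simps)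
  thus ?thesis
    unfolding approx_def using tendsto_add[OF d(1) e(1)] d(2) e(2)
    by (intro exI[of _ "\<lambda>n. d n + e n"]) auto
qed

lemma approx_smult:
  assumes "approx u f"
  shows "approx (\<lambda>n. scale c (u n)) (\<lambda>t. c * f t)"
proof -
  obtain d where d: "d \<longlonglongrightarrow> 0" "\<And>n. 0 \<le> d n" "\<And>n. bounded_by (\<lambda>t. f t - comb (u n) t) (d n)"
    using assms(1) unfolding approx_def by blast
  have "bounded_by (\<lambda>t. c * f t - comb (scale c (u n)) t) (cmod c * d n)" for n
    using bounded_by_smult[OF d(3), of c] by (simp add: lin_comb_scale algebra_simps)
  thus ?thesis
    unfolding approx_def using tendsto_mult_right_zero[OF d(1), of "cmod c"] d(2)
    by (intro exI[of _ "\<lambda>n. cmod c * d n"]) (auto simp: mult.commute)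
qed

lemma kspace_approx: "f \<in> kspace \<longleftrightarrow> (\<exists>u. approx u f)"
proof
  assume "f \<in> kspace"
  hence "\<forall>n. \<exists>u. bounded_by (\<lambda>t. f t - comb u t) (inverse (real (Suc n)))"
    by (simp add: kspace_def)
  then obtain u where "\<And>n. bounded_by (\<lambda>t. f t - comb (u n) t) (inverse (real (Suc n)))"
    by metis
  hence "approx u f"
    unfolding approx_def using LIMSEQ_inverse_real_of_nat
    by (intro exI[of _ "\<lambda>n. inverse (real (Suc n))"]) auto
  thus "\<exists>u. approx u f" by blast
next
  assume "\<exists>u. approx u f"
  then obtain u where "approx u f" by blast
  then obtain e where e: "e \<longlonglongrightarrow> 0" "\<And>n. bounded_by (\<lambda>t. f t - comb (u n) t) (e n)"
    unfolding approx_def by blast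
  show "f \<in> kspace"
    unfolding kspace_def
  proof safe
    fix r :: real assume "r > 0"
    then obtain n where "e n < r"
      using order_tendstoD(2)[OF e(1), of r] by (auto simp: eventually_sequentially)
    moreover have "bounded_by (\<lambda>t. f t - comb (u n) t) r" if "e n < r"
      unfolding bounded_by_def
      using bounded_byD[OF e(2)[of n]] mult_right_mono[of "e n" r] that N_nonneg
      by (meson less_imp_le order_trans)
    ultimately show "\<exists>u. bounded_by (\<lambda>t. f t - comb u t) r" by blast
  qed
qed

lemma comb_kspace [simp]: "comb u \<in> kspace"
  using approx_comb kspace_approx by blast

lemma kernel_comb: "k s = comb [(1, s)]"
  by simp

lemma kernel_kspace [simp]: "k s \<in> kspace"
  by (subst kernel_comb) (rule comb_kspace)

lemma kspace_add: "f \<in> kspace \<Longrightarrow> g \<in> kspace \<Longrightarrow> (\<lambda>t. f t + g t) \<in> kspace"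
  using approx_add kspace_approx by blast

lemma kspace_smult: "f \<in> kspace \<Longrightarrow> (\<lambda>t. c * f t) \<in> kspace"
  using approx_smult kspace_approx by blast

lemma kspace_zero: "(\<lambda>t. 0) \<in> kspace"
  using comb_kspace[of "[]"] by simp

lemma kspace_bounded:
  assumes "f \<in> kspace"
  obtains c where "0 \<le> c" "bounded_by f c"
proof -
  obtain u where "bounded_by (\<lambda>t. f t - comb u t) 1"
    using assms zero_less_one unfolding kspace_def by blast
  from bounded_by_add[OF this bounded_by_comb[of u]]
  have "bounded_by f (1 + N u)" by simp
  thus thesis using that[of "1 + N u"] by simp
qed

lemma approx_point:
  assumes "approx u f"
  shows "(\<lambda>n. comb (u n) t) \<longlonglongrightarrow> f t"
proof -
  obtain e where e: "e \<longlonglongrightarrow> 0" "\<And>n. bounded_by (\<lambda>t. f t - comb (u n) t) (e n)"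
    using assms unfolding approx_def by blast
  have "(\<lambda>n. f t - comb (u n) t) \<longlonglongrightarrow> 0"
    by (rule Lim_null_comparison[OF _ tendsto_mult_left_zero[OF e(1), of "N [(1, t)]"]])
       (use bounded_by_point[OF e(2)] in auto)
  from tendsto_diff[OF tendsto_const[of "f t"] this] show ?thesis by simp
qed

text \<open>A bounded \<open>f\<close> sees two lists only through \<open>N\<close> of their
  difference, and this is at most the sum of the two errors. It makes \<open>ip\<close> independent
  of the choice of the sequence.\<close>

lemma approx_ev_diff:
  assumes f: "f \<in> kspace" and "approx u g" "approx v g"
  shows "(\<lambda>n. ev f (u n) - ev f (v n)) \<longlonglongrightarrow> 0"
proof -
  obtain c where c: "0 \<le> c" "bounded_by f c" using f by (rule kspace_bounded) blast
  obtain d where d: "d \<longlonglongrightarrow> 0" "\<And>n. 0 \<le> d n" "\<And>n. bounded_by (\<lambda>t. g t - comb (u n) t) (d n)"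
    using assms(2) unfolding approx_def by blast
  obtain e where e: "e \<longlonglongrightarrow> 0" "\<And>n. 0 \<le> e n" "\<And>n. bounded_by (\<lambda>t. g t - comb (v n) t) (e n)"
    using assms(3) unfolding approx_def by blast
  have "cmod (ev f (u n) - ev f (v n)) \<le> c * (d n + e n)" for n
    using bounded_byD[OF c(2), of "diff (u n) (v n)"]
      mult_left_mono[OF N_diff_le[OF d(3) e(3) d(2) e(2), of n n] c(1)]
    by simp
  hence bound: "\<forall>n. norm (ev f (u n) - ev f (v n)) \<le> c * (d n + e n)" by blast
  have "(\<lambda>n. c * (d n + e n)) \<longlonglongrightarrow> 0"
    using tendsto_mult_right_zero[OF tendsto_add[OF d(1) e(1), simplified], of c] by simp
  thus ?thesis by (rule Lim_null_comparison[OF always_eventually[OF bound]])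
qed

lemma approx_ev_convergent:
  assumes f: "f \<in> kspace" and v: "approx v g"
  shows "convergent (\<lambda>n. ev f (v n))"
proof (rule Cauchy_convergent, rule metric_CauchyI)
  fix r :: real assume r: "r > 0"
  obtain c where c: "0 \<le> c" "bounded_by f c" using f by (rule kspace_bounded) blast
  obtain e where e: "e \<longlonglongrightarrow> 0" "\<And>n. 0 \<le> e n" "\<And>n. bounded_by (\<lambda>t. g t - comb (v n) t) (e n)"
    using v unfolding approx_def by blast
  have "(\<lambda>n. c * e n) \<longlonglongrightarrow> 0"
    using tendsto_mult_right_zero[OF e(1), of c] by simp
  then obtain M where M: "\<And>n. n \<ge> M \<Longrightarrow> c * e n < r / 2"
    using order_tendstoD(2)[of "\<lambda>n. c * e n" 0 sequentially "r / 2"] r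
    by (auto simp: eventually_sequentially)
  show "\<exists>M. \<forall>m\<ge>M. \<forall>n\<ge>M. dist (ev f (v m)) (ev f (v n)) < r"
  proof (intro exI allI impI)
    fix m n assume "M \<le> m" "M \<le> n"
    have "cmod (ev f (v m) - ev f (v n)) \<le> c * (e m + e n)"
      using bounded_byD[OF c(2), of "diff (v m) (v n)"]
        mult_left_mono[OF N_diff_le[OF e(3) e(3) e(2) e(2), of m n] c(1)]
      by simp
    also have "\<dots> < r" using M[OF \<open>M \<le> m\<close>] M[OF \<open>M \<le> n\<close>] by (simp add: distrib_left)
    finally show "dist (ev f (v m)) (ev f (v n)) < r" by (simp add: dist_norm)
  qed
qed

lemma ip_lim:
  assumes f: "f \<in> kspace" and v: "approx v g"
  shows "(\<lambda>n. ev f (v n)) \<longlonglongrightarrow> ip f g"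
proof -
  define w where "w = (SOME v. approx v g)"
  have w: "approx w g" unfolding w_def by (rule someI[of _ v]) (rule v)
  have "(\<lambda>n. ev f (w n)) \<longlonglongrightarrow> ip f g"
    using approx_ev_convergent[OF f w] by (simp add: ip_def w_def convergent_LIMSEQ_iff)
  from tendsto_add[OF approx_ev_diff[OF f v w] this] show ?thesis by simp
qed

lemma approx_N_bounded:
  assumes "approx u f"
  obtains c where "0 \<le> c" "\<And>n. N (u n) \<le> c"
proof -
  obtain e where e: "e \<longlonglongrightarrow> 0" "\<And>n. 0 \<le> e n" "\<And>n. bounded_by (\<lambda>t. f t - comb (u n) t) (e n)"
    using assms unfolding approx_def by blast
  obtain b where b: "\<And>n. e n \<le> b"
    using convergent_imp_Bseq[OF convergentI[OF e(1)]]
    unfolding Bseq_def real_norm_def by (meson abs_le_D1)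
  have "f \<in> kspace" using assms kspace_approx by blast
  then obtain c where c: "0 \<le> c" "bounded_by f c" by (rule kspace_bounded) blast
  have "N (u n) \<le> b + c" for n
  proof -
    have "bounded_by (\<lambda>t. comb (u n) t) (e n + c)"
      using bounded_by_add[OF bounded_by_minus[OF e(3)] c(2)] by simp
    hence "N (u n) \<le> e n + c" using e(2) c(1) by (intro N_le) auto
    thus ?thesis using b[of n] by simp
  qed
  moreover have "0 \<le> b + c" using b[of 0] e(2)[of 0] c(1) by simp
  ultimately show thesis using that by blast
qed

text \<open>Replacing \<open>f\<close> by its approximant costs at most the error times
  \<open>N (v n)\<close>, which is bounded. In this form, hermitian symmetry and positivity of the
  kernel form pass to \<open>ip\<close>.\<close>

lemma ip_lim_kform:
  assumes u: "approx u f" and v: "approx v g"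
  shows "(\<lambda>n. B (u n) (v n)) \<longlonglongrightarrow> ip f g"
proof -
  have f: "f \<in> kspace" using u kspace_approx by blast
  obtain c where c: "0 \<le> c" "\<And>n. N (v n) \<le> c" using v approx_N_bounded by blast
  obtain e where e: "e \<longlonglongrightarrow> 0" "\<And>n. 0 \<le> e n" "\<And>n. bounded_by (\<lambda>t. f t - comb (u n) t) (e n)"
    using u unfolding approx_def by blast
  have "cmod (ev f (v n) - B (u n) (v n)) \<le> e n * c" for n
    using bounded_byD[OF e(3)[of n], of "v n"] mult_left_mono[OF c(2)[of n] e(2)[of n]]
    by (simp add: ev_diff kform_def)
  hence bound: "\<forall>n. norm (ev f (v n) - B (u n) (v n)) \<le> e n * c" by blast
  have "(\<lambda>n. ev f (v n) - B (u n) (v n)) \<longlonglongrightarrow> 0"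
    by (rule Lim_null_comparison[OF always_eventually[OF bound] tendsto_mult_left_zero[OF e(1)]])
  from tendsto_diff[OF ip_lim[OF f v] this] show ?thesis by simp
qed

lemma ip_comb: "f \<in> kspace \<Longrightarrow> ip f (comb v) = ev f v"
  using ip_lim[OF _ approx_comb, of f v] by (simp add: LIMSEQ_const_iff)

lemma ip_kernel: "f \<in> kspace \<Longrightarrow> ip f (k t) = f t"
  using ip_comb[of f "[(1, t)]"] by simp

lemma ip_commute: "f \<in> kspace \<Longrightarrow> g \<in> kspace \<Longrightarrow> ip f g = cnj (ip g f)"
proof -
  assume "f \<in> kspace" "g \<in> kspace"
  then obtain u v where uv: "approx u f" "approx v g" by (auto simp: kspace_approx)
  have "(\<lambda>n. cnj (B (v n) (u n))) \<longlonglongrightarrow> cnj (ip g f)"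
    by (intro tendsto_cnj ip_lim_kform uv)
  hence "(\<lambda>n. B (u n) (v n)) \<longlonglongrightarrow> cnj (ip g f)"
    by (subst kform_commute)
  with ip_lim_kform[OF uv] show ?thesis by (rule LIMSEQ_unique)
qed

lemma ip_add: "f \<in> kspace \<Longrightarrow> g \<in> kspace \<Longrightarrow> h \<in> kspace \<Longrightarrow> ip (\<lambda>t. f t + g t) h = ip f h + ip g h"
proof -
  assume f: "f \<in> kspace" and g: "g \<in> kspace" and "h \<in> kspace"
  then obtain w where w: "approx w h" by (auto simp: kspace_approx)
  show ?thesis
    using ip_lim[OF kspace_add[OF f g] w] tendsto_add[OF ip_lim[OF f w] ip_lim[OF g w]]
    unfolding ev_add by (rule LIMSEQ_unique)
qed

lemma ip_smult: "f \<in> kspace \<Longrightarrow> h \<in> kspace \<Longrightarrow> ip (\<lambda>t. c * f t) h = c * ip f h"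
proof -
  assume f: "f \<in> kspace" and "h \<in> kspace"
  then obtain w where w: "approx w h" by (auto simp: kspace_approx)
  show ?thesis
    using ip_lim[OF kspace_smult[OF f] w] tendsto_mult_left[OF ip_lim[OF f w], of c]
    unfolding ev_smult by (rule LIMSEQ_unique)
qed

lemma ip_self:
  assumes "f \<in> kspace"
  shows "ip f f \<in> \<real>\<^sub>\<ge>\<^sub>0"
proof -
  obtain u where u: "approx u f" using assms by (auto simp: kspace_approx)
  note lim = ip_lim_kform[OF u u]
  have "Re (ip f f) \<ge> 0"
    by (rule tendsto_lowerbound[OF tendsto_Re[OF lim]]) (auto simp: kform_nonneg)
  moreover have "Im (ip f f) = 0"
    using ip_commute[OF assms assms] by (metis complex_cnj_cancel_iff Reals_cnj_iff complex_is_Real_iff)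
  ultimately show ?thesis by (simp add: complex_nonneg_Reals_iff)
qed

section \<open>Norm and completeness\<close>

definition nrm :: "('s \<Rightarrow> complex) \<Rightarrow> real" where
  "nrm f = sqrt (Re (ip f f))"

lemma approx_N_lim:
  assumes "approx u f"
  shows "(\<lambda>n. N (u n)) \<longlonglongrightarrow> nrm f"
  unfolding knorm_def nrm_def by (intro tendsto_intros ip_lim_kform assms)

lemma nrm_nonneg: "f \<in> kspace \<Longrightarrow> 0 \<le> nrm f"
  using ip_self by (simp add: nrm_def complex_nonneg_Reals_iff)

lemma bounded_by_nrm:
  assumes "f \<in> kspace"
  shows "bounded_by f (nrm f)"
  unfolding bounded_by_def
proof
  fix v
  obtain u where u: "approx u f" using assms by (auto simp: kspace_approx)
  have "(\<lambda>n. ev (comb (u n)) v) \<longlonglongrightarrow> ev f v"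
    by (intro tendsto_ev approx_point u)
  moreover have "(\<lambda>n. N (u n) * N v) \<longlonglongrightarrow> nrm f * N v"
    by (intro tendsto_intros approx_N_lim u)
  ultimately show "cmod (ev f v) \<le> nrm f * N v"
    using Cauchy_Schwarz by (intro LIMSEQ_le[OF tendsto_norm]) (auto simp: kform_def)
qed

text \<open>As in \<open>N_le\<close>, \<open>f\<close> is tested on its own approximants. With
  \<open>bounded_by_nrm\<close> this identifies \<open>nrm\<close> with the dual norm, so that norm
  estimates reduce to \<open>bounded_by\<close>.\<close>

lemma nrm_le:
  assumes f: "f \<in> kspace" and "bounded_by f c" "0 \<le> c"
  shows "nrm f \<le> c"
proof -
  obtain u where u: "approx u f" using f by (auto simp: kspace_approx)
  have "cmod (ip f f) \<le> c * nrm f"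
    by (rule LIMSEQ_le[OF tendsto_norm[OF ip_lim[OF f u]] tendsto_mult_left[OF approx_N_lim[OF u]]])
       (use bounded_byD[OF assms(2)] in auto)
  hence "(nrm f)\<^sup>2 \<le> c * nrm f"
    using complex_Re_le_cmod[of "ip f f"] ip_self[OF f]
    by (simp add: nrm_def complex_nonneg_Reals_iff)
  thus ?thesis
    using assms(3) nrm_nonneg[OF f] by (cases "nrm f = 0") (auto simp: power2_eq_square)
qed

text \<open>Point evaluations are bounded; this gives definiteness although \<open>N\<close> itself
  is only a seminorm.\<close>

lemma nrm_zero_imp:
  assumes "f \<in> kspace" "nrm f = 0"
  shows "f = (\<lambda>t. 0)"
  using bounded_by_point[OF bounded_by_nrm[OF assms(1)]] assms(2) by auto

lemma kspace_diff: "f \<in> kspace \<Longrightarrow> g \<in> kspace \<Longrightarrow> (\<lambda>t. f t - g t) \<in> kspace"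
  using kspace_add[of f "\<lambda>t. - 1 * g t"] kspace_smult[of g "-1"] by simp

lemma nrm_zero [simp]: "nrm (\<lambda>t. 0) = 0"
proof (rule antisym)
  show "nrm (\<lambda>t. 0) \<le> 0"
    by (rule nrm_le[OF kspace_zero bounded_by_zero]) simp
qed (rule nrm_nonneg[OF kspace_zero])

lemma nrm_eq_zero_iff: "f \<in> kspace \<Longrightarrow> nrm f = 0 \<longleftrightarrow> f = (\<lambda>t. 0)"
  using nrm_zero_imp nrm_zero by blast

lemma nrm_add_le:
  assumes "f \<in> kspace" "g \<in> kspace"
  shows "nrm (\<lambda>t. f t + g t) \<le> nrm f + nrm g"
  using assms by (intro nrm_le kspace_add bounded_by_add bounded_by_nrm add_nonneg_nonneg nrm_nonneg)

lemma nrm_minus_commute: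
  assumes "f \<in> kspace" "g \<in> kspace"
  shows "nrm (\<lambda>t. f t - g t) = nrm (\<lambda>t. g t - f t)"
proof -
  have "nrm (\<lambda>t. f t - g t) \<le> nrm (\<lambda>t. g t - f t)" if "f \<in> kspace" "g \<in> kspace" for f g
    by (rule nrm_le[OF kspace_diff[OF that] bounded_by_minus[OF bounded_by_nrm[OF kspace_diff[OF that(2,1)]]]
        nrm_nonneg[OF kspace_diff[OF that(2,1)]]])
  thus ?thesis using assms by (intro antisym)
qed

text \<open>Bounded point evaluations give a pointwise limit. The dual norm bound passes to it
  because each of its inequalities involves only finitely many values of the function.\<close>

lemma kspace_Cauchy_convergent:
  assumes s: "range \<sigma> \<subseteq> kspace"
    and cau: "\<And>e. 0 < e \<Longrightarrow> \<exists>M. \<forall>m\<ge>M. \<forall>n\<ge>M. nrm (\<lambda>t. \<sigma> m t - \<sigma> n t) < e"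
  shows "\<exists>f\<in>kspace. (\<lambda>n. nrm (\<lambda>t. \<sigma> n t - f t)) \<longlonglongrightarrow> 0"
proof -
  have s: "\<sigma> n \<in> kspace" for n using s by auto
  have "Cauchy (\<lambda>n. \<sigma> n t)" for t
  proof (rule metric_CauchyI)
    fix r :: real assume r: "r > 0"
    \<comment> \<open>The summand 1 keeps \<open>c\<close> positive when the kernel vanishes at
      \<open>t\<close>.\<close>
    define c where "c = N [(1, t)] + 1"
    have c: "c > 0" by (simp add: c_def add_nonneg_pos)
    obtain M where M: "\<And>m n. m \<ge> M \<Longrightarrow> n \<ge> M \<Longrightarrow> nrm (\<lambda>t. \<sigma> m t - \<sigma> n t) < r / c"
      using cau[of "r / c"] r c by auto
    show "\<exists>M. \<forall>m\<ge>M. \<forall>n\<ge>M. dist (\<sigma> m t) (\<sigma> n t) < r"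
    proof (intro exI allI impI)
      fix m n assume mn: "m \<ge> M" "n \<ge> M"
      have "cmod (\<sigma> m t - \<sigma> n t) \<le> nrm (\<lambda>t. \<sigma> m t - \<sigma> n t) * N [(1, t)]"
        by (rule bounded_by_point[OF bounded_by_nrm[OF kspace_diff[OF s s]]])
      also have "\<dots> \<le> nrm (\<lambda>t. \<sigma> m t - \<sigma> n t) * c"
        using nrm_nonneg[OF kspace_diff[OF s s]] by (intro mult_left_mono) (auto simp: c_def)
      also have "\<dots> < r" using M[OF mn] c by (simp add: field_simps)
      finally show "dist (\<sigma> m t) (\<sigma> n t) < r" by (simp add: dist_norm)
    qed
  qed
  hence "\<forall>t. \<exists>l. (\<lambda>n. \<sigma> n t) \<longlonglongrightarrow> l"
    using Cauchy_convergent convergent_def by blast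
  then obtain f where f: "\<And>t. (\<lambda>n. \<sigma> n t) \<longlonglongrightarrow> f t" by metis
  have bd: "\<exists>M. \<forall>n\<ge>M. bounded_by (\<lambda>t. \<sigma> n t - f t) e" if e: "e > 0" for e
  proof -
    obtain M where M: "\<And>m n. m \<ge> M \<Longrightarrow> n \<ge> M \<Longrightarrow> nrm (\<lambda>t. \<sigma> m t - \<sigma> n t) < e"
      using cau[OF e] by auto
    have "cmod (ev (\<lambda>t. \<sigma> n t - f t) v) \<le> e * N v" if n: "n \<ge> M" for n v
    proof (rule tendsto_upperbound)
      show "(\<lambda>m. cmod (ev (\<lambda>t. \<sigma> n t - \<sigma> m t) v)) \<longlonglongrightarrow> cmod (ev (\<lambda>t. \<sigma> n t - f t) v)"
        by (intro tendsto_norm tendsto_ev tendsto_intros f)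
      have "cmod (ev (\<lambda>t. \<sigma> n t - \<sigma> m t) v) \<le> e * N v" if "m \<ge> M" for m
        using bounded_byD[OF bounded_by_nrm[OF kspace_diff[OF s s]], of n m v]
          mult_right_mono[OF less_imp_le[OF M[OF n that]] N_nonneg[of v]] by linarith
      thus "\<forall>\<^sub>F m in sequentially. cmod (ev (\<lambda>t. \<sigma> n t - \<sigma> m t) v) \<le> e * N v"
        by (auto simp: eventually_sequentially)
    qed simp
    thus ?thesis by (auto simp: bounded_by_def)
  qed
  have fs: "f \<in> kspace"
    unfolding kspace_def
  proof safe
    fix e :: real assume "e > 0"
    then obtain n where n: "bounded_by (\<lambda>t. \<sigma> n t - f t) (e / 2)"
      using bd[of "e / 2"] by auto
    obtain u where "bounded_by (\<lambda>t. \<sigma> n t - comb u t) (e / 2)"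
      using s[of n] \<open>e > 0\<close> half_gt_zero unfolding kspace_def by blast
    from bounded_by_diff_trans[OF bounded_by_minus[OF n] this]
    show "\<exists>u. bounded_by (\<lambda>t. f t - comb u t) e" by auto
  qed
  moreover have "(\<lambda>n. nrm (\<lambda>t. \<sigma> n t - f t)) \<longlonglongrightarrow> 0"
  proof (rule metric_LIMSEQ_I)
    fix e :: real assume "e > 0"
    then obtain M where M: "\<And>n. n \<ge> M \<Longrightarrow> bounded_by (\<lambda>t. \<sigma> n t - f t) (e / 2)"
      using bd[of "e / 2"] by auto
    have "nrm (\<lambda>t. \<sigma> n t - f t) < e" if "n \<ge> M" for n
      using nrm_le[OF kspace_diff[OF s fs] M[OF that]] \<open>e > 0\<close> by simp
    thus "\<exists>M. \<forall>n\<ge>M. dist (nrm (\<lambda>t. \<sigma> n t - f t)) 0 < e"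
      using nrm_nonneg[OF kspace_diff[OF s fs]] by auto
  qed
  ultimately show ?thesis by blast
qed



section \<open>The function space as a Hilbert space record\<close>

text \<open>
  The operations ignore arguments outside the carrier, so that the distance derived from the norm is
  symmetric and nonnegative on the whole type, as the locale \<open>Metric_space\<close> demands.
\<close>

definition clip :: "('s \<Rightarrow> complex) \<Rightarrow> 's \<Rightarrow> complex" where
  "clip f = (if f \<in> kspace then f else (\<lambda>t. 0))"

definition rkhs :: "('s \<Rightarrow> complex) hilbert" where
  "rkhs = \<lparr>carrier = kspace, mult = undefined, one = undefined, zero = (\<lambda>t. 0),
     add = (\<lambda>f g t. clip f t + clip g t), smult = (\<lambda>c f t. c * f t),
     hinner = (\<lambda>f g. ip (clip f) (clip g))\<rparr>"

lemma clip_kspace [simp]: "clip f \<in> kspace"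
  by (simp add: clip_def kspace_zero)

lemma clip_id: "f \<in> kspace \<Longrightarrow> clip f = f"
  by (simp add: clip_def)

lemma rkhs_simps [simp]:
  "carrier rkhs = kspace" "\<zero>\<^bsub>rkhs\<^esub> = (\<lambda>t. 0)" "c \<odot>\<^bsub>rkhs\<^esub> f = (\<lambda>t. c * f t)"
  by (simp_all add: rkhs_def)

lemma rkhs_add: "f \<in> kspace \<Longrightarrow> g \<in> kspace \<Longrightarrow> f \<oplus>\<^bsub>rkhs\<^esub> g = (\<lambda>t. f t + g t)"
  by (simp add: rkhs_def clip_id)

lemma rkhs_hinner: "f \<in> kspace \<Longrightarrow> g \<in> kspace \<Longrightarrow> hinner rkhs f g = ip f g"
  by (simp add: rkhs_def clip_id)

lemma hnorm_rkhs: "hnorm rkhs f = nrm (clip f)"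
  by (simp add: hnorm_def nrm_def rkhs_def)

text \<open>Addition clips both arguments, so the definite description behind the additive inverse
  has a unique solution even when \<open>g\<close> lies outside the carrier.\<close>

lemma rkhs_minus: "f \<ominus>\<^bsub>rkhs\<^esub> g = (\<lambda>t. clip f t - clip g t)"
proof -
  have neg: "(\<lambda>t. - clip g t) \<in> kspace"
    using kspace_smult[of "clip g" "-1"] by simp
  have "y = (\<lambda>t. - clip g t)" if "(\<lambda>t. clip g t + y t) = (\<lambda>t. 0)" for y
    using that by (auto simp: fun_eq_iff add_eq_0_iff)
  hence "\<ominus>\<^bsub>rkhs\<^esub> g = (\<lambda>t. - clip g t)"
    unfolding a_inv_def m_inv_def using neg
    by (intro the_equality) (auto simp: rkhs_def clip_id)
  thus ?thesis
    using neg by (simp add: a_minus_def rkhs_def clip_id)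
qed

lemma hnorm_rkhs_minus: "hnorm rkhs (f \<ominus>\<^bsub>rkhs\<^esub> g) = nrm (\<lambda>t. clip f t - clip g t)"
  by (simp add: hnorm_rkhs rkhs_minus clip_id kspace_diff)

lemma Metric_space_rkhs: "Metric_space kspace (\<lambda>f g. hnorm rkhs (f \<ominus>\<^bsub>rkhs\<^esub> g))"
  unfolding hnorm_rkhs_minus
proof
  fix f g :: "'s \<Rightarrow> complex"
  show "0 \<le> nrm (\<lambda>t. clip f t - clip g t)"
    by (intro nrm_nonneg kspace_diff clip_kspace)
  show "nrm (\<lambda>t. clip f t - clip g t) = nrm (\<lambda>t. clip g t - clip f t)"
    by (intro nrm_minus_commute clip_kspace)
next
  fix f g assume "f \<in> kspace" "g \<in> kspace"
  thus "nrm (\<lambda>t. clip f t - clip g t) = 0 \<longleftrightarrow> f = g"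
    by (simp add: nrm_eq_zero_iff kspace_diff clip_id fun_eq_iff)
next
  fix f g h assume "f \<in> kspace" "g \<in> kspace" "h \<in> kspace"
  thus "nrm (\<lambda>t. clip f t - clip h t) \<le> nrm (\<lambda>t. clip f t - clip g t) + nrm (\<lambda>t. clip g t - clip h t)"
    using nrm_add_le[of "\<lambda>t. f t - g t" "\<lambda>t. g t - h t"] by (simp add: kspace_diff clip_id)
qed

lemma mcomplete_rkhs: "Metric_space.mcomplete kspace (\<lambda>f g. hnorm rkhs (f \<ominus>\<^bsub>rkhs\<^esub> g))"
proof -
  interpret Metric_space kspace "\<lambda>f g. hnorm rkhs (f \<ominus>\<^bsub>rkhs\<^esub> g)"
    by (rule Metric_space_rkhs)
  show ?thesis
    unfolding mcomplete_def
  proof (intro allI impI)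
    fix \<sigma> :: "nat \<Rightarrow> 's \<Rightarrow> complex"
    assume *: "MCauchy \<sigma>"
    hence \<sigma>: "range \<sigma> \<subseteq> kspace" by (simp add: MCauchy_def)
    hence [simp]: "clip (\<sigma> n) = \<sigma> n" for n by (auto intro: clip_id)
    have "\<exists>M. \<forall>m\<ge>M. \<forall>n\<ge>M. nrm (\<lambda>t. \<sigma> m t - \<sigma> n t) < e" if "0 < e" for e
      using * that unfolding MCauchy_def by (simp add: hnorm_rkhs_minus)
    from kspace_Cauchy_convergent[OF \<sigma> this]
    have "\<exists>f\<in>kspace. (\<lambda>n. nrm (\<lambda>t. \<sigma> n t - f t)) \<longlonglongrightarrow> 0" by blast
    then obtain f where f: "f \<in> kspace" "(\<lambda>n. nrm (\<lambda>t. \<sigma> n t - f t)) \<longlonglongrightarrow> 0" by blast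
    have "limitin mtopology \<sigma> f sequentially"
      unfolding limitin_metric
      using f \<sigma> order_tendstoD(2)[OF f(2)] by (auto simp: hnorm_rkhs_minus clip_id image_subset_iff)
    thus "\<exists>f. limitin mtopology \<sigma> f sequentially" by blast
  qed
qed

lemma hilbert_space_rkhs: "hilbert_space rkhs"
proof -
  have ab: "abelian_group rkhs"
  proof (rule abelian_groupI)
    fix f assume f: "f \<in> carrier rkhs"
    show "\<exists>y\<in>carrier rkhs. y \<oplus>\<^bsub>rkhs\<^esub> f = \<zero>\<^bsub>rkhs\<^esub>"
      using kspace_smult[of f "-1"] f by (intro bexI[of _ "\<lambda>t. - 1 * f t"]) (auto simp: rkhs_add)
  qed (auto simp: rkhs_add kspace_add kspace_zero algebra_simps)
  show ?thesis
  proof (rule hilbert_space.intro)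
    show "module (ring_of_type_algebra :: complex ring) rkhs"
      by (rule moduleI[OF cring_from_type_algebra ab])
         (auto simp: rkhs_add kspace_add kspace_smult ring_of_type_algebra_def algebra_simps)
    show "hilbert_space_axioms rkhs"
    proof
      fix f assume f: "f \<in> carrier rkhs"
      show "hinner rkhs f f \<in> \<real>\<^sub>\<ge>\<^sub>0"
        using f by (simp add: rkhs_hinner ip_self)
      have "ip f f = 0 \<longleftrightarrow> nrm f = 0"
        using ip_self[of f] f
        by (simp add: nrm_def complex_nonneg_Reals_iff complex_eq_iff)
      thus "hinner rkhs f f = 0 \<longleftrightarrow> f = \<zero>\<^bsub>rkhs\<^esub>"
        using f by (simp add: rkhs_hinner nrm_eq_zero_iff)
    qed (auto simp: rkhs_add rkhs_hinner kspace_add kspace_smult ip_add ip_smult mcomplete_rkhs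
          intro: ip_commute)
  qed
qed

lemma ip_Cauchy_Schwarz:
  assumes "f \<in> kspace" "g \<in> kspace"
  shows "cmod (ip f g) \<le> nrm f * nrm g"
proof -
  obtain u v where uv: "approx u f" "approx v g" using assms by (auto simp: kspace_approx)
  show ?thesis
    by (rule LIMSEQ_le[OF tendsto_norm[OF ip_lim_kform[OF uv]]
          tendsto_mult[OF approx_N_lim[OF uv(1)] approx_N_lim[OF uv(2)]]])
       (auto intro: Cauchy_Schwarz)
qed

lemma ip_diff_left:
  assumes "f \<in> kspace" "g \<in> kspace" "h \<in> kspace"
  shows "ip (\<lambda>t. f t - g t) h = ip f h - ip g h"
  using ip_add[of f "\<lambda>t. - 1 * g t" h] ip_smult[of g h "-1"] kspace_smult[of g "-1"] assms by simp

lemma ip_diff_right: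
  assumes "f \<in> kspace" "g \<in> kspace" "h \<in> kspace"
  shows "ip h (\<lambda>t. f t - g t) = ip h f - ip h g"
  using assms by (simp add: ip_commute[of h] kspace_diff ip_diff_left)

lemma nrm_comb: "nrm (comb u) = N u"
  by (simp add: nrm_def knorm_def ip_comb kform_def)

text \<open>Transfers linear relations between kernel functions to the values of every element of
  the space.\<close>

lemma ev_cong_comb:
  assumes "f \<in> kspace" "comb u = comb v"
  shows "ev f u = ev f v"
  using ip_comb[OF assms(1)] assms(2) by metis


subsection \<open>Projections given by their action on the kernel functions\<close>

definition extend :: "('s \<Rightarrow> (complex \<times> 's) list) \<Rightarrow> (complex \<times> 's) list \<Rightarrow> (complex \<times> 's) list" where
  "extend p u = concat (map (\<lambda>(c, s). scale c (p s)) u)"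

text \<open>
  \<open>lift p\<close> is the adjoint of the operator that sends the kernel function at \<open>s\<close> to \<open>comb (p s)\<close>.
\<close>

definition lift :: "('s \<Rightarrow> (complex \<times> 's) list) \<Rightarrow> ('s \<Rightarrow> complex) \<Rightarrow> 's \<Rightarrow> complex" where
  "lift p f t = ev f (p t)"

text \<open>These are algebraic conditions that can be checked on an explicit \<open>p\<close>. That
  \<open>p\<close> is compatible with the relations between kernel functions and acts as a
  contraction is derived from them.\<close>

definition symmetric_idem :: "('s \<Rightarrow> (complex \<times> 's) list) \<Rightarrow> bool" where
  "symmetric_idem p \<longleftrightarrow> (\<forall>s t. lift p (k s) t = cnj (lift p (k t) s)) \<and>
     (\<forall>f\<in>kspace. lift p (lift p f) = lift p f)"

lemma ev_extend: "ev f (extend p v) = ev (lift p f) v"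
  by (induction v) (auto simp: extend_def lift_def)

lemma comb_extend: "comb (extend p u) t = (\<Sum>(c, s)\<leftarrow>u. c * comb (p s) t)"
  by (induction u) (auto simp: extend_def lin_comb_append lin_comb_scale)

lemma lift_add: "lift p (\<lambda>t. f t + g t) = (\<lambda>t. lift p f t + lift p g t)"
  by (simp add: lift_def[abs_def] ev_add)

lemma lift_diff: "lift p (\<lambda>t. f t - g t) = (\<lambda>t. lift p f t - lift p g t)"
  by (simp add: lift_def[abs_def] ev_diff)

lemma lift_smult: "lift p (\<lambda>t. c * f t) = (\<lambda>t. c * lift p f t)"
  by (simp add: lift_def[abs_def] ev_smult)

lemma lift_comb_sum: "lift p (comb u) t = (\<Sum>(c, s)\<leftarrow>u. c * lift p (k s) t)"
  by (induction u) (auto simp: lift_add lift_smult, simp add: lift_def)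

lemma ev_lift_comb: "ev (lift p (comb u)) v = (\<Sum>(d, t)\<leftarrow>v. \<Sum>(c, s)\<leftarrow>u. cnj d * (c * lift p (k s) t))"
  by (induction v) (auto simp: lift_comb_sum sum_list_const_mult split_def)

context
  fixes p assumes p: "symmetric_idem p"
begin

text \<open>Symmetry makes \<open>lift p\<close>, introduced as an adjoint, agree on kernel
  functions with the operator given by \<open>p\<close> itself.\<close>

lemma lift_kernel: "lift p (k s) = comb (p s)"
proof
  fix t
  have "lift p (k s) t = cnj (lift p (k t) s)"
    using p unfolding symmetric_idem_def by blast
  thus "lift p (k s) t = comb (p s) t"
    by (simp add: lift_def ev_kernel)
qed

lemma lift_comb: "lift p (comb u) = comb (extend p u)"
  by (simp add: fun_eq_iff lift_comb_sum comb_extend lift_kernel)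

lemma lift_idem: "f \<in> kspace \<Longrightarrow> lift p (lift p f) = lift p f"
  using p by (simp add: symmetric_idem_def)

text \<open>For a symmetric idempotent the norm square of the image of \<open>u\<close> is the inner
  product of the image with \<open>u\<close>; Cauchy-Schwarz then gives a contraction, so the
  operator extends to limits.\<close>

lemma N_extend_le: "N (extend p u) \<le> N u"
proof -
  have "B (extend p u) (extend p u) = B (extend p u) u"
    by (simp add: kform_def ev_extend lift_comb[symmetric] lift_idem)
  hence "(N (extend p u))\<^sup>2 \<le> N (extend p u) * N u"
    using Cauchy_Schwarz[of "extend p u" u] complex_Re_le_cmod[of "B (extend p u) u"]
    by (simp add: N_square)
  thus ?thesis
    using N_nonneg[of "extend p u"] N_nonneg[of u] by (cases "N (extend p u) = 0") (auto simp: power2_eq_square)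
qed

lemma bounded_by_lift:
  assumes "bounded_by f c" "0 \<le> c"
  shows "bounded_by (lift p f) c"
  unfolding bounded_by_def
  using bounded_byD[OF assms(1), of "extend p _"] mult_left_mono[OF N_extend_le assms(2)]
  by (fastforce simp: ev_extend intro: order_trans)

lemma approx_lift:
  assumes "approx u f"
  shows "approx (\<lambda>n. extend p (u n)) (lift p f)"
proof -
  obtain e where e: "e \<longlonglongrightarrow> 0" "\<And>n. 0 \<le> e n" "\<And>n. bounded_by (\<lambda>t. f t - comb (u n) t) (e n)"
    using assms unfolding approx_def by blast
  have "bounded_by (\<lambda>t. lift p f t - comb (extend p (u n)) t) (e n)" for n
    using bounded_by_lift[OF e(3) e(2)] by (simp add: lift_diff lift_comb)
  thus ?thesis unfolding approx_def using e by blast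
qed

lemma lift_kspace: "f \<in> kspace \<Longrightarrow> lift p f \<in> kspace"
  using approx_lift kspace_approx by blast

lemma nrm_lift_le: "f \<in> kspace \<Longrightarrow> nrm (lift p f) \<le> nrm f"
  by (intro nrm_le lift_kspace bounded_by_lift bounded_by_nrm nrm_nonneg)

lemma ip_lift:
  assumes "f \<in> kspace" "g \<in> kspace"
  shows "ip (lift p f) g = ip f (lift p g)"
proof -
  obtain v where v: "approx v g" using assms by (auto simp: kspace_approx)
  show ?thesis
    using ip_lim[OF lift_kspace[OF assms(1)] v] ip_lim[OF assms(1) approx_lift[OF v]]
    unfolding ev_extend by (rule LIMSEQ_unique)
qed

lemma projection_op_lift: "projection_op rkhs (lift p)"
  unfolding projection_op_def bounded_op_def
  by (auto simp: lift_kspace rkhs_add kspace_add lift_add lift_smult hnorm_rkhs clip_id rkhs_hinner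
      ip_lift lift_idem intro!: exI[of _ 1] nrm_lift_le)

lemma positive_op_lift: "positive_op rkhs (lift p)"
  unfolding positive_op_def
proof safe
  show "bounded_op rkhs rkhs (lift p)"
    using projection_op_lift by (simp add: projection_op_def)
  fix f assume "f \<in> carrier rkhs"
  thus "hinner rkhs (lift p f) f \<in> \<real>\<^sub>\<ge>\<^sub>0"
    using ip_lift[of "lift p f" f] ip_self[of "lift p f"]
    by (simp add: rkhs_hinner lift_kspace lift_idem)
qed

end

section \<open>Convergence, measurability and weak* sums of the projections\<close>

lemma tendsto_sum_list:
  assumes "\<And>x. x \<in> set xs \<Longrightarrow> (\<lambda>n. f x n :: complex) \<longlonglongrightarrow> g x"
  shows "(\<lambda>n. \<Sum>x\<leftarrow>xs. f x n) \<longlonglongrightarrow> (\<Sum>x\<leftarrow>xs. g x)"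
  using assms by (induction xs) (auto intro!: tendsto_intros)

lemma borel_measurable_sum_list:
  assumes "\<And>x. x \<in> set xs \<Longrightarrow> (f x :: _ \<Rightarrow> complex) \<in> borel_measurable M"
  shows "(\<lambda>y. \<Sum>x\<leftarrow>xs. f x y) \<in> borel_measurable M"
  using assms by (induction xs) auto

text \<open>An e/3 argument: the error \<open>d m\<close> is uniform in \<open>n\<close>.\<close>

lemma tendsto_uniform_approx:
  fixes b :: "nat \<Rightarrow> complex"
  assumes "\<And>m n. cmod (b n - a m n) \<le> d m" "\<And>m. cmod (b' - a' m) \<le> d m"
    and "d \<longlonglongrightarrow> 0" "\<And>m. a m \<longlonglongrightarrow> a' m"
  shows "b \<longlonglongrightarrow> b'"
proof (rule metric_LIMSEQ_I)
  fix e :: real assume e: "e > 0"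
  then obtain m where m: "d m < e / 3"
    using order_tendstoD(2)[OF assms(3), of "e / 3"] by (auto simp: eventually_sequentially)
  obtain n0 where n0: "\<And>n. n \<ge> n0 \<Longrightarrow> cmod (a m n - a' m) < e / 3"
    using LIMSEQ_D[OF assms(4), of "e / 3" m] e by auto
  show "\<exists>n0. \<forall>n\<ge>n0. dist (b n) b' < e"
  proof (intro exI allI impI)
    fix n assume "n \<ge> n0"
    have "b n - b' = (b n - a m n) + (a m n - a' m) - (b' - a' m)" by simp
    hence "cmod (b n - b') \<le> cmod (b n - a m n) + cmod (a m n - a' m) + cmod (b' - a' m)"
      using norm_triangle_ineq4[of "(b n - a m n) + (a m n - a' m)" "b' - a' m"]
        norm_triangle_ineq[of "b n - a m n" "a m n - a' m"] by simp
    thus "dist (b n) b' < e"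
      using assms(1)[of n m] assms(2)[of m] m n0[OF \<open>n \<ge> n0\<close>] by (simp add: dist_norm)
  qed
qed

text \<open>Kernel functions have dense span and all operators are contractions, so convergence of
  the matrix coefficients at kernel functions is enough.\<close>

lemma ip_lift_tendsto:
  assumes q: "\<And>n. symmetric_idem (q n)" and p: "symmetric_idem p"
    and lim: "\<And>s t. (\<lambda>n. lift (q n) (k s) t) \<longlonglongrightarrow> lift p (k s) t"
    and f: "f \<in> kspace" and g: "g \<in> kspace"
  shows "(\<lambda>n. ip (lift (q n) f) g) \<longlonglongrightarrow> ip (lift p f) g"
proof -
  obtain u v where u: "approx u f" and v: "approx v g" using f g by (auto simp: kspace_approx)
  obtain d where d: "d \<longlonglongrightarrow> 0" "\<And>n. 0 \<le> d n" "\<And>n. bounded_by (\<lambda>t. f t - comb (u n) t) (d n)"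
    using u unfolding approx_def by blast
  obtain e where e: "e \<longlonglongrightarrow> 0" "\<And>n. 0 \<le> e n" "\<And>n. bounded_by (\<lambda>t. g t - comb (v n) t) (e n)"
    using v unfolding approx_def by blast
  obtain c where c: "0 \<le> c" "\<And>n. N (u n) \<le> c" using u approx_N_bounded by blast
  \<comment> \<open>The bound does not involve \<open>r\<close>; it is uniform along the sequence
    and covers its limit as well.\<close>
  have bound: "cmod (ip (lift r f) g - ip (lift r (comb (u m))) (comb (v m))) \<le> d m * nrm g + c * e m"
    if r: "symmetric_idem r" for r m
  proof -
    let ?u = "comb (u m)" and ?v = "comb (v m)"
    have "ip (lift r f) g - ip (lift r ?u) ?v =
      ip (lift r (\<lambda>t. f t - ?u t)) g + ip (lift r ?u) (\<lambda>t. g t - ?v t)"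
      by (simp add: lift_diff ip_diff_left ip_diff_right lift_kspace[OF r] f g)
    moreover have "cmod (ip (lift r (\<lambda>t. f t - ?u t)) g) \<le> nrm (\<lambda>t. f t - ?u t) * nrm g"
      using ip_Cauchy_Schwarz[OF lift_kspace[OF r kspace_diff[OF f comb_kspace]] g]
        mult_right_mono[OF nrm_lift_le[OF r kspace_diff[OF f comb_kspace]] nrm_nonneg[OF g]]
      by (rule order_trans)
    moreover have "nrm (\<lambda>t. f t - ?u t) * nrm g \<le> d m * nrm g"
      by (intro mult_right_mono nrm_le kspace_diff f comb_kspace d nrm_nonneg g)
    moreover have "cmod (ip (lift r ?u) (\<lambda>t. g t - ?v t)) \<le> nrm (lift r ?u) * nrm (\<lambda>t. g t - ?v t)"
      by (intro ip_Cauchy_Schwarz lift_kspace[OF r] kspace_diff g comb_kspace)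
    moreover have "nrm (lift r ?u) * nrm (\<lambda>t. g t - ?v t) \<le> c * e m"
      using nrm_lift_le[OF r comb_kspace, of "u m"] c(2)[of m]
      by (intro mult_mono nrm_le[OF kspace_diff[OF g comb_kspace] e(3,2)] nrm_nonneg kspace_diff g
          comb_kspace c) (simp add: nrm_comb)
    ultimately show ?thesis
      using norm_triangle_ineq[of "ip (lift r (\<lambda>t. f t - ?u t)) g" "ip (lift r ?u) (\<lambda>t. g t - ?v t)"]
      by simp
  qed
  show ?thesis
  proof (rule tendsto_uniform_approx[OF bound[OF q] bound[OF p]])
    show "(\<lambda>m. d m * nrm g + c * e m) \<longlonglongrightarrow> 0"
      using tendsto_add[OF tendsto_mult_left_zero[OF d(1)] tendsto_mult_right_zero[OF e(1)]] by simp
    show "(\<lambda>n. ip (lift (q n) (comb (u m))) (comb (v m)))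
        \<longlonglongrightarrow> ip (lift p (comb (u m))) (comb (v m))" for m
      unfolding ip_comb[OF lift_kspace[OF q comb_kspace]] ip_comb[OF lift_kspace[OF p comb_kspace]] ev_lift_comb
      by (intro tendsto_sum_list) (auto simp: split_def intro!: tendsto_sum_list tendsto_intros lim)
  qed
qed

text \<open>One pair of approximating sequences of \<open>f\<close> and \<open>g\<close> serves all
  \<open>x\<close>, since every \<open>lift (p x)\<close> is a contraction. The coefficient is thus
  a pointwise limit of finite sums of measurable functions.\<close>

lemma ip_lift_measurable:
  assumes p: "\<And>x. symmetric_idem (p x)"
    and meas: "\<And>s t. (\<lambda>x. lift (p x) (k s) t) \<in> borel_measurable M"
    and f: "f \<in> kspace" and g: "g \<in> kspace"
  shows "(\<lambda>x. ip (lift (p x) f) g) \<in> borel_measurable M"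
proof -
  obtain u v where u: "approx u f" and v: "approx v g" using f g by (auto simp: kspace_approx)
  show ?thesis
  proof (rule borel_measurable_LIMSEQ_metric)
    show "(\<lambda>x. B (extend (p x) (u n)) (v n)) \<in> borel_measurable M" for n
      unfolding kform_def lift_comb[OF p, symmetric] ev_lift_comb
      by (intro borel_measurable_sum_list)
         (auto simp: split_def intro!: borel_measurable_sum_list borel_measurable_times meas)
    show "(\<lambda>n. B (extend (p x) (u n)) (v n)) \<longlonglongrightarrow> ip (lift (p x) f) g" for x
      by (intro ip_lim_kform approx_lift p u v)
  qed
qed

text \<open>The partial sums are required to be symmetric idempotents \<open>q n\<close>, hence
  contractions. This supplies a summable majorant independent of \<open>n\<close>, and the limit may
  be taken inside the series over the test vectors.\<close>

lemma weak_star_sums_lift: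
  assumes p: "\<And>i. symmetric_idem (p i)" and q: "\<And>n. symmetric_idem (q n)" and r: "symmetric_idem r"
    and partial: "\<And>f n t. f \<in> kspace \<Longrightarrow> lift (q n) f t = (\<Sum>i<n. lift (p i) f t)"
    and lim: "\<And>s t. (\<lambda>n. lift (q n) (k s) t) \<longlonglongrightarrow> lift r (k s) t"
  shows "weak_star_sums rkhs (\<lambda>i. lift (p i)) (lift r)"
  unfolding weak_star_sums_def
proof (intro allI impI)
  fix \<xi> \<eta> :: "nat \<Rightarrow> 's \<Rightarrow> complex"
  assume "square_summable rkhs \<xi> \<and> square_summable rkhs \<eta>"
  hence mem: "\<xi> n \<in> kspace" "\<eta> n \<in> kspace"
    and "summable (\<lambda>n. (nrm (\<xi> n))\<^sup>2)" "summable (\<lambda>n. (nrm (\<eta> n))\<^sup>2)" for n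
    by (auto simp: square_summable_def hnorm_rkhs clip_id image_subset_iff)
  hence sq: "summable (\<lambda>n. (nrm (\<xi> n))\<^sup>2 + (nrm (\<eta> n))\<^sup>2)" by (intro summable_add)
  have bound: "cmod (ip (lift p' (\<xi> n)) (\<eta> n)) \<le> (nrm (\<xi> n))\<^sup>2 + (nrm (\<eta> n))\<^sup>2"
    if "symmetric_idem p'" for p' n
  proof -
    have "cmod (ip (lift p' (\<xi> n)) (\<eta> n)) \<le> nrm (lift p' (\<xi> n)) * nrm (\<eta> n)"
      by (intro ip_Cauchy_Schwarz lift_kspace[OF that] mem)
    also have "\<dots> \<le> nrm (\<xi> n) * nrm (\<eta> n)"
      by (intro mult_right_mono nrm_lift_le[OF that] mem nrm_nonneg)
    also have "\<dots> \<le> (nrm (\<xi> n))\<^sup>2 + (nrm (\<eta> n))\<^sup>2"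
      using sum_squares_bound[of "nrm (\<xi> n)" "nrm (\<eta> n)"] nrm_nonneg[OF mem(1)] nrm_nonneg[OF mem(2)]
        mult_nonneg_nonneg[OF nrm_nonneg[OF mem(1)[of n]] nrm_nonneg[OF mem(2)[of n]]] by linarith
    finally show ?thesis .
  qed
  have summ: "summable (\<lambda>n. ip (lift (p i) (\<xi> n)) (\<eta> n))" for i
    by (rule summable_comparison_test'[OF sq bound[OF p]])
  have kspace_sum: "(\<lambda>t. \<Sum>i<m. lift (p i) f t) \<in> kspace \<and>
      ip (\<lambda>t. \<Sum>i<m. lift (p i) f t) g = (\<Sum>i<m. ip (lift (p i) f) g)"
    if "f \<in> kspace" "g \<in> kspace" for m f g
  proof (induction m)
    case 0
    show ?case using kspace_zero ip_smult[OF kspace_zero that(2), of 0] by simp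
  next
    case (Suc m)
    thus ?case using that by (simp add: kspace_add ip_add lift_kspace[OF p])
  qed
  have part: "ip (lift (q m) f) g = (\<Sum>i<m. ip (lift (p i) f) g)" if "f \<in> kspace" "g \<in> kspace" for m f g
  proof -
    have "lift (q m) f = (\<lambda>t. \<Sum>i<m. lift (p i) f t)" using partial[OF that(1)] by (intro ext)
    thus ?thesis using kspace_sum[OF that, of m] by simp
  qed
  have "(\<lambda>m. \<Sum>n. ip (lift (q m) (\<xi> n)) (\<eta> n)) \<longlonglongrightarrow> (\<Sum>n. ip (lift r (\<xi> n)) (\<eta> n))"
    by (rule tannerys_theorem[THEN conjunct2, THEN conjunct2, OF _ _ sq])
       (auto intro!: ip_lift_tendsto q r lim mem bound always_eventually)
  moreover have "(\<Sum>n. ip (lift (q m) (\<xi> n)) (\<eta> n)) = (\<Sum>i<m. \<Sum>n. ip (lift (p i) (\<xi> n)) (\<eta> n))" for m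
    by (subst suminf_sum[symmetric]) (auto simp: summ part mem)
  ultimately show "(\<lambda>i. \<Sum>n. hinner rkhs (lift (p i) (\<xi> n)) (\<eta> n)) sums
      (\<Sum>n. hinner rkhs (lift r (\<xi> n)) (\<eta> n))"
    by (simp add: sums_def rkhs_hinner mem lift_kspace[OF p] lift_kspace[OF r])
qed

end


section \<open>Positive operators and commuting channels\<close>

context hilbert_space
begin

lemma carrier_ring_of_type [simp]: "carrier (ring_of_type_algebra :: complex ring) = UNIV"
  by (simp add: ring_of_type_algebra_def)

lemma hinner_add_right:
  assumes "\<xi> \<in> carrier H" "\<eta> \<in> carrier H" "\<zeta> \<in> carrier H"
  shows "hinner H \<zeta> (\<xi> \<oplus> \<eta>) = hinner H \<zeta> \<xi> + hinner H \<zeta> \<eta>"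
  using assms by (simp add: hinner_commute[of \<zeta>] hinner_add_left)

lemma hinner_smult_right:
  assumes "\<xi> \<in> carrier H" "\<eta> \<in> carrier H"
  shows "hinner H \<xi> (c \<odot> \<eta>) = cnj c * hinner H \<xi> \<eta>"
  using assms by (simp add: hinner_commute[of \<xi>] hinner_smult_left)

lemma hinner_zero_left [simp]:
  assumes "\<eta> \<in> carrier H"
  shows "hinner H \<zero> \<eta> = 0"
  using hinner_add_left[of \<zero> \<zero> \<eta>] assms by simp

lemma hinner_zero_right [simp]:
  assumes "\<eta> \<in> carrier H"
  shows "hinner H \<eta> \<zero> = 0"
  using assms by (simp add: hinner_commute[of \<eta>])

lemma hinner_diff_left:
  assumes "\<xi> \<in> carrier H" "\<eta> \<in> carrier H" "\<zeta> \<in> carrier H"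
  shows "hinner H (\<xi> \<ominus> \<eta>) \<zeta> = hinner H \<xi> \<zeta> - hinner H \<eta> \<zeta>"
proof -
  have "hinner H (\<ominus> \<eta>) \<zeta> + hinner H \<eta> \<zeta> = 0"
    using assms by (simp add: hinner_add_left[symmetric] l_neg)
  thus ?thesis
    using assms by (simp add: a_minus_def hinner_add_left algebra_simps add_eq_0_iff)
qed

lemma hinner_diff_right:
  assumes "\<xi> \<in> carrier H" "\<eta> \<in> carrier H" "\<zeta> \<in> carrier H"
  shows "hinner H \<zeta> (\<xi> \<ominus> \<eta>) = hinner H \<zeta> \<xi> - hinner H \<zeta> \<eta>"
  using assms by (simp add: hinner_commute[of \<zeta>] hinner_diff_left)

lemma hinner_eqI:
  assumes "\<xi> \<in> carrier H" "\<eta> \<in> carrier H"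
    and "\<And>\<zeta>. \<zeta> \<in> carrier H \<Longrightarrow> hinner H \<xi> \<zeta> = hinner H \<eta> \<zeta>"
  shows "\<xi> = \<eta>"
proof -
  have "\<xi> \<ominus> \<eta> \<in> carrier H" using assms(1,2) by simp
  hence "\<xi> \<ominus> \<eta> = \<zero>"
    using assms by (simp add: hinner_eq_zero_iff[symmetric] hinner_diff_left)
  moreover have "(\<xi> \<ominus> \<eta>) \<oplus> \<eta> = \<xi>"
    using assms(1,2) by (simp add: a_minus_def a_assoc l_neg)
  ultimately show ?thesis using assms(1,2) by simp
qed

lemma hinner_self_nonneg: "\<xi> \<in> carrier H \<Longrightarrow> 0 \<le> Re (hinner H \<xi> \<xi>)"
  using hinner_nonneg by (simp add: complex_nonneg_Reals_iff)

lemma hinner_Cauchy_Schwarz: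
  assumes "\<xi> \<in> carrier H" "\<eta> \<in> carrier H"
  shows "(cmod (hinner H \<xi> \<eta>))\<^sup>2 \<le> Re (hinner H \<xi> \<xi>) * Re (hinner H \<eta> \<eta>)"
proof -
  have "(cmod (hinner H \<eta> \<xi>))\<^sup>2 \<le> Re (hinner H \<xi> \<xi>) * Re (hinner H \<eta> \<eta>)"
  proof (rule semi_inner_Cauchy_Schwarz)
    fix z
    let ?v = "\<xi> \<oplus> z \<odot> \<eta>"
    have 1: "hinner H ?v ?v =
        hinner H \<xi> \<xi> + (cnj z * hinner H \<xi> \<eta> + z * hinner H \<eta> \<xi>) + z * cnj z * hinner H \<eta> \<eta>"
      using assms by (simp add: hinner_add_left hinner_add_right hinner_smult_left hinner_smult_right algebra_simps)
    have 2: "Re (cnj z * hinner H \<xi> \<eta> + z * hinner H \<eta> \<xi>) = 2 * Re (z * hinner H \<eta> \<xi>)"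
      using assms by (subst hinner_commute[of \<xi>]) auto
    have 3: "Re (z * cnj z * hinner H \<eta> \<eta>) = (cmod z)\<^sup>2 * Re (hinner H \<eta> \<eta>)"
      by (simp only: complex_norm_square[symmetric] Re_of_real_mult)
    have "Re (hinner H ?v ?v) =
        Re (hinner H \<xi> \<xi>) + 2 * Re (z * hinner H \<eta> \<xi>) + (cmod z)\<^sup>2 * Re (hinner H \<eta> \<eta>)"
      by (simp only: 1 plus_complex.sel(1) 2[unfolded plus_complex.sel(1)] 3)
    moreover have "0 \<le> Re (hinner H ?v ?v)"
      using assms by (intro hinner_self_nonneg) auto
    ultimately show "0 \<le> Re (hinner H \<xi> \<xi>) + 2 * Re (z * hinner H \<eta> \<xi>) + (cmod z)\<^sup>2 * Re (hinner H \<eta> \<eta>)"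
      by simp
  qed (use assms hinner_self_nonneg in auto)
  thus ?thesis
    using assms by (subst hinner_commute) auto
qed

section \<open>Operators between 0 and the identity, and Riesz' sequence\<close>

definition lin_op :: "('v \<Rightarrow> 'v) \<Rightarrow> bool" where
  "lin_op T \<longleftrightarrow> T \<in> carrier H \<rightarrow> carrier H \<and>
     (\<forall>\<xi>\<in>carrier H. \<forall>\<eta>\<in>carrier H. T (\<xi> \<oplus> \<eta>) = T \<xi> \<oplus> T \<eta>) \<and>
     (\<forall>c. \<forall>\<xi>\<in>carrier H. T (c \<odot> \<xi>) = c \<odot> T \<xi>)"

lemma lin_op_closed [intro, simp]: "lin_op T \<Longrightarrow> \<xi> \<in> carrier H \<Longrightarrow> T \<xi> \<in> carrier H"
  by (auto simp: lin_op_def)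

lemma lin_op_add: "lin_op T \<Longrightarrow> \<xi> \<in> carrier H \<Longrightarrow> \<eta> \<in> carrier H \<Longrightarrow> T (\<xi> \<oplus> \<eta>) = T \<xi> \<oplus> T \<eta>"
  by (auto simp: lin_op_def)

lemma lin_op_smult: "lin_op T \<Longrightarrow> \<xi> \<in> carrier H \<Longrightarrow> T (c \<odot> \<xi>) = c \<odot> T \<xi>"
  by (auto simp: lin_op_def)

lemma lin_op_diff:
  assumes "lin_op T" "\<xi> \<in> carrier H" "\<eta> \<in> carrier H"
  shows "T (\<xi> \<ominus> \<eta>) = T \<xi> \<ominus> T \<eta>"
proof -
  have "T (\<xi> \<ominus> \<eta>) \<oplus> T \<eta> = T \<xi>"
    using assms by (simp add: lin_op_add[symmetric] a_minus_def a_assoc l_neg)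
  moreover have "T (\<xi> \<ominus> \<eta>) \<oplus> T \<eta> \<ominus> T \<eta> = T (\<xi> \<ominus> \<eta>)"
    using assms by (simp add: a_minus_def a_assoc r_neg)
  ultimately show ?thesis by simp
qed

lemma lin_op_comp: "lin_op S \<Longrightarrow> lin_op T \<Longrightarrow> lin_op (\<lambda>\<xi>. S (T \<xi>))"
  by (auto simp: lin_op_def Pi_iff)

lemma lin_op_id: "lin_op (\<lambda>\<xi>. \<xi>)"
  by (auto simp: lin_op_def)

lemma smult_diff_right:
  assumes "\<xi> \<in> carrier H" "\<eta> \<in> carrier H"
  shows "c \<odot> (\<xi> \<ominus> \<eta>) = c \<odot> \<xi> \<ominus> c \<odot> \<eta>"
  using assms by (intro hinner_eqI) (auto simp: hinner_smult_left hinner_diff_left algebra_simps)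

text \<open>The symmetric operators with 0 \<le> T \<le> I in the sense of quadratic forms; the
  upper bound is what keeps T - T^2 positive.\<close>

definition effect :: "('v \<Rightarrow> 'v) \<Rightarrow> bool" where
  "effect T \<longleftrightarrow> lin_op T \<and> (\<forall>\<xi>\<in>carrier H. \<forall>\<eta>\<in>carrier H. hinner H (T \<xi>) \<eta> = hinner H \<xi> (T \<eta>)) \<and>
     (\<forall>\<xi>\<in>carrier H. 0 \<le> Re (hinner H (T \<xi>) \<xi>) \<and> Re (hinner H (T \<xi>) \<xi>) \<le> Re (hinner H \<xi> \<xi>))"

lemma effectD:
  assumes "effect T"
  shows "lin_op T" "\<xi> \<in> carrier H \<Longrightarrow> \<eta> \<in> carrier H \<Longrightarrow> hinner H (T \<xi>) \<eta> = hinner H \<xi> (T \<eta>)"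
    "\<xi> \<in> carrier H \<Longrightarrow> 0 \<le> Re (hinner H (T \<xi>) \<xi>)"
    "\<xi> \<in> carrier H \<Longrightarrow> Re (hinner H (T \<xi>) \<xi>) \<le> Re (hinner H \<xi> \<xi>)"
  using assms by (auto simp: effect_def)

text \<open>T - T^2 = T (I - T)^2 + T^2 (I - T). The first summand has the quadratic form of
  \<open>T\<close> at \<xi> - T \<xi>, the second is nonnegative by T \<le> I at T \<xi>. The upper
  bound is T - T^2 \<le> T \<le> I.\<close>

lemma effect_step:
  assumes T: "effect T"
  shows "effect (\<lambda>\<xi>. T \<xi> \<ominus> T (T \<xi>))"
proof -
  note lin = effectD(1)[OF T] and sym = effectD(2)[OF T]
  have "lin_op (\<lambda>\<xi>. T \<xi> \<ominus> T (T \<xi>))"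
    unfolding lin_op_def
  proof (intro conjI ballI allI funcsetI)
    fix \<xi> \<eta> assume "\<xi> \<in> carrier H" "\<eta> \<in> carrier H"
    thus "T (\<xi> \<oplus> \<eta>) \<ominus> T (T (\<xi> \<oplus> \<eta>)) = T \<xi> \<ominus> T (T \<xi>) \<oplus> (T \<eta> \<ominus> T (T \<eta>))"
      using lin by (intro hinner_eqI) (auto simp: lin_op_add hinner_add_left hinner_diff_left)
  qed (use lin in \<open>auto simp: lin_op_smult smult_diff_right\<close>)
  moreover have "hinner H (T \<xi> \<ominus> T (T \<xi>)) \<eta> = hinner H \<xi> (T \<eta> \<ominus> T (T \<eta>))"
    if "\<xi> \<in> carrier H" "\<eta> \<in> carrier H" for \<xi> \<eta>
    using that lin by (simp add: hinner_diff_left hinner_diff_right sym)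
  moreover have "0 \<le> Re (hinner H (T \<xi> \<ominus> T (T \<xi>)) \<xi>) \<and>
      Re (hinner H (T \<xi> \<ominus> T (T \<xi>)) \<xi>) \<le> Re (hinner H \<xi> \<xi>)" if \<xi>: "\<xi> \<in> carrier H" for \<xi>
  proof -
    let ?d = "\<xi> \<ominus> T \<xi>"
    have "hinner H (T ?d) ?d = hinner H (T \<xi>) \<xi> - 2 * hinner H (T \<xi>) (T \<xi>) + hinner H (T (T \<xi>)) (T \<xi>)"
      using \<xi> lin sym[of "T \<xi>" \<xi>] by (simp add: lin_op_diff hinner_diff_left hinner_diff_right)
    moreover have "0 \<le> Re (hinner H (T ?d) ?d)"
      using \<xi> lin by (intro effectD(3)[OF T]) auto
    moreover have "Re (hinner H (T (T \<xi>)) (T \<xi>)) \<le> Re (hinner H (T \<xi>) (T \<xi>))"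
      using \<xi> lin by (intro effectD(4)[OF T]) auto
    moreover have "0 \<le> Re (hinner H (T \<xi>) (T \<xi>))"
      using \<xi> lin by (intro hinner_self_nonneg) auto
    moreover have "hinner H (T \<xi> \<ominus> T (T \<xi>)) \<xi> = hinner H (T \<xi>) \<xi> - hinner H (T \<xi>) (T \<xi>)"
      using \<xi> lin by (simp add: hinner_diff_left sym)
    ultimately show ?thesis
      using effectD(4)[OF T \<xi>] by simp
  qed
  ultimately show ?thesis by (auto simp: effect_def)
qed

text \<open>
  Riesz' sequence \<open>T\<^sub>0 = T\<close>, \<open>T\<^sub>n\<^sub>+\<^sub>1 = T\<^sub>n - T\<^sub>n\<^sup>2\<close>: the squares of its members sum up to \<open>T\<close>. This replaces
  the square root of \<open>T\<close> in the proof that products of commuting positive operators are positive.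
\<close>

primrec riesz :: "('v \<Rightarrow> 'v) \<Rightarrow> nat \<Rightarrow> 'v \<Rightarrow> 'v" where
  "riesz T 0 = T"
| "riesz T (Suc n) = (\<lambda>\<xi>. riesz T n \<xi> \<ominus> riesz T n (riesz T n \<xi>))"

lemma effect_riesz: "effect T \<Longrightarrow> effect (riesz T n)"
  by (induction n) (auto intro: effect_step)

lemma riesz_closed [simp]: "effect T \<Longrightarrow> \<xi> \<in> carrier H \<Longrightarrow> riesz T n \<xi> \<in> carrier H"
  using effectD(1)[OF effect_riesz] by blast

text \<open>Telescoping of \<open>riesz T m - riesz T (Suc m)\<close>, which is the square of
  \<open>riesz T m\<close>; symmetry moves one factor to \<eta>.\<close>

lemma riesz_sum:
  assumes T: "effect T" and "\<xi> \<in> carrier H" "\<eta> \<in> carrier H"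
  shows "hinner H (T \<xi>) \<eta> =
    (\<Sum>m<n. hinner H (riesz T m \<xi>) (riesz T m \<eta>)) + hinner H (riesz T n \<xi>) \<eta>"
proof (induction n)
  case (Suc n)
  have "hinner H (riesz T n (riesz T n \<xi>)) \<eta> = hinner H (riesz T n \<xi>) (riesz T n \<eta>)"
    using assms by (intro effectD(2)[OF effect_riesz]) auto
  with Suc assms show ?case by (simp add: hinner_diff_left)
qed simp

text \<open>The remainder in \<open>riesz_sum\<close> is nonnegative, so the squared norms have
  partial sums bounded by the form of \<open>T\<close> at \<xi>, and the terms tend to 0.\<close>

lemma riesz_tendsto_0:
  assumes T: "effect T" and \<xi>: "\<xi> \<in> carrier H"
  shows "(\<lambda>n. Re (hinner H (riesz T n \<xi>) (riesz T n \<xi>))) \<longlonglongrightarrow> 0"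
proof (rule summable_LIMSEQ_zero, rule summableI_nonneg_bounded)
  fix n
  show "0 \<le> Re (hinner H (riesz T n \<xi>) (riesz T n \<xi>))"
    using assms by (intro hinner_self_nonneg) auto
  show "(\<Sum>m<n. Re (hinner H (riesz T m \<xi>) (riesz T m \<xi>))) \<le> Re (hinner H (T \<xi>) \<xi>)"
    using arg_cong[OF riesz_sum[OF T \<xi> \<xi>, of n], of Re] effectD(3)[OF effect_riesz[OF T] \<xi>, of n]
    by simp
qed

lemma riesz_commute:
  assumes T: "effect T" and S: "lin_op S" and comm: "\<And>\<xi>. \<xi> \<in> carrier H \<Longrightarrow> S (T \<xi>) = T (S \<xi>)"
  shows "\<xi> \<in> carrier H \<Longrightarrow> S (riesz T n \<xi>) = riesz T n (S \<xi>)"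
proof (induction n arbitrary: \<xi>)
  case (Suc n)
  thus ?case using S T by (simp add: lin_op_diff)
qed (simp add: comm)

section \<open>Positive semidefinite operator kernels\<close>

text \<open>The index type is kept apart from the points at which a kernel is evaluated, so that a
  family of points with repetitions can be substituted.\<close>

definition psd_ops :: "('i \<Rightarrow> 'i \<Rightarrow> 'v \<Rightarrow> 'v) \<Rightarrow> bool" where
  "psd_ops T \<longleftrightarrow> (\<forall>I \<eta>. finite I \<longrightarrow> (\<forall>i. \<eta> i \<in> carrier H) \<longrightarrow>
     0 \<le> Re (\<Sum>i\<in>I. \<Sum>j\<in>I. hinner H (T i j (\<eta> i)) (\<eta> j)))"

lemma psd_opsD:
  "psd_ops T \<Longrightarrow> finite I \<Longrightarrow> (\<And>i. \<eta> i \<in> carrier H) \<Longrightarrow>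
    0 \<le> Re (\<Sum>i\<in>I. \<Sum>j\<in>I. hinner H (T i j (\<eta> i)) (\<eta> j))"
  unfolding psd_ops_def by blast

text \<open>\<open>E\<close> is the sum of the squares of its Riesz sequence, whose members commute
  with \<open>T\<close>. Each square can therefore be distributed over the two vectors, which leaves
  the form of \<open>T\<close> at the vectors \<open>riesz E m (\<eta> i)\<close>. The remainder
  tends to 0 by Cauchy-Schwarz.\<close>

lemma psd_ops_effect_mult:
  fixes T :: "'i \<Rightarrow> 'i \<Rightarrow> 'v \<Rightarrow> 'v"
  assumes E: "effect E" and T: "\<And>i j. lin_op (T i j)"
    and comm: "\<And>i j \<xi>. \<xi> \<in> carrier H \<Longrightarrow> T i j (E \<xi>) = E (T i j \<xi>)"
    and psd: "psd_ops T"
  shows "psd_ops (\<lambda>i j \<xi>. E (T i j \<xi>))"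
  unfolding psd_ops_def
proof (intro allI impI)
  fix I :: "'i set" and \<eta> :: "'i \<Rightarrow> 'v"
  assume I: "finite I" and "\<forall>i. \<eta> i \<in> carrier H"
  hence \<eta>: "\<eta> i \<in> carrier H" for i by blast
  have rT: "T i j (riesz E n \<xi>) = riesz E n (T i j \<xi>)" if "\<xi> \<in> carrier H" for i j n \<xi>
    using that by (intro riesz_commute E T comm)
  let ?S = "Re (\<Sum>i\<in>I. \<Sum>j\<in>I. hinner H (E (T i j (\<eta> i))) (\<eta> j))"
  define r where "r n = Re (\<Sum>i\<in>I. \<Sum>j\<in>I. hinner H (riesz E n (T i j (\<eta> i))) (\<eta> j))" for n
  have "hinner H (riesz E m (T i j (\<eta> i))) (riesz E m (\<eta> j))
      = hinner H (T i j (riesz E m (\<eta> i))) (riesz E m (\<eta> j))" for i j m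
    by (simp add: rT \<eta>)
  hence eq: "hinner H (E (T i j (\<eta> i))) (\<eta> j) =
      (\<Sum>m<n. hinner H (T i j (riesz E m (\<eta> i))) (riesz E m (\<eta> j))) + hinner H (riesz E n (T i j (\<eta> i))) (\<eta> j)"
    for i j n
    using riesz_sum[OF E, of "T i j (\<eta> i)" "\<eta> j" n] \<eta> T by simp
  have "r n \<le> ?S" for n
  proof -
    have "(\<Sum>i\<in>I. \<Sum>j\<in>I. hinner H (E (T i j (\<eta> i))) (\<eta> j)) =
      (\<Sum>m<n. \<Sum>i\<in>I. \<Sum>j\<in>I. hinner H (T i j (riesz E m (\<eta> i))) (riesz E m (\<eta> j))) +
      (\<Sum>i\<in>I. \<Sum>j\<in>I. hinner H (riesz E n (T i j (\<eta> i))) (\<eta> j))"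
      by (simp only: eq[of _ _ n] sum.distrib sum.swap[of _ "{..<n}" I])
    moreover have "0 \<le> Re (\<Sum>m<n. \<Sum>i\<in>I. \<Sum>j\<in>I. hinner H (T i j (riesz E m (\<eta> i))) (riesz E m (\<eta> j)))"
      unfolding Re_sum[of _ "{..<n}"]
      by (intro sum_nonneg psd_opsD[OF psd I]) (simp add: \<eta> E)
    ultimately show ?thesis by (simp add: r_def)
  qed
  moreover have "r \<longlonglongrightarrow> 0"
  proof -
    have "(\<lambda>n. hinner H (riesz E n (T i j (\<eta> i))) (\<eta> j)) \<longlonglongrightarrow> 0" for i j
    proof -
      let ?\<xi> = "T i j (\<eta> i)"
      have \<xi>: "?\<xi> \<in> carrier H" using T \<eta> by simp
      have "(\<lambda>n. sqrt (Re (hinner H (riesz E n ?\<xi>) (riesz E n ?\<xi>)) * Re (hinner H (\<eta> j) (\<eta> j)))) \<longlonglongrightarrow> sqrt (0 * Re (hinner H (\<eta> j) (\<eta> j)))"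
        by (intro tendsto_intros riesz_tendsto_0[OF E \<xi>])
      hence lim: "(\<lambda>n. sqrt (Re (hinner H (riesz E n ?\<xi>) (riesz E n ?\<xi>)) * Re (hinner H (\<eta> j) (\<eta> j)))) \<longlonglongrightarrow> 0"
        by simp
      have "\<forall>n. norm (hinner H (riesz E n ?\<xi>) (\<eta> j)) \<le>
          sqrt (Re (hinner H (riesz E n ?\<xi>) (riesz E n ?\<xi>)) * Re (hinner H (\<eta> j) (\<eta> j)))"
        using hinner_Cauchy_Schwarz[OF riesz_closed[OF E \<xi>] \<eta>] by (intro allI real_le_rsqrt)
      from Lim_null_comparison[OF always_eventually[OF this] lim] show ?thesis .
    qed
    hence "(\<lambda>n. Re (\<Sum>i\<in>I. \<Sum>j\<in>I. hinner H (riesz E n (T i j (\<eta> i))) (\<eta> j))) \<longlonglongrightarrow> Re (\<Sum>i\<in>I. \<Sum>j\<in>I. 0)"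
      by (intro tendsto_Re tendsto_sum)
    thus ?thesis by (simp add: r_def[abs_def])
  qed
  ultimately show "0 \<le> ?S" by (intro LIMSEQ_le_const2[of r 0]) auto
qed

text \<open>The double sum is the squared norm of the sum of the \<eta> i. That vector is
  characterised by its inner products, which makes an induction on the index set sufficient.\<close>

lemma psd_ops_id: "psd_ops (\<lambda>(i :: 'i) j \<xi>. \<xi>)"
  unfolding psd_ops_def
proof (intro allI impI)
  fix I :: "'i set" and \<eta> :: "'i \<Rightarrow> 'v"
  assume "finite I" and \<eta>: "\<forall>i. \<eta> i \<in> carrier H"
  hence "\<exists>v\<in>carrier H. \<forall>w\<in>carrier H. hinner H v w = (\<Sum>i\<in>I. hinner H (\<eta> i) w)"
  proof (induction I rule: finite_induct)
    case empty
    show ?case by (rule bexI[of _ \<zero>]) auto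
  next
    case (insert i I)
    then obtain v where "v \<in> carrier H" "\<forall>w\<in>carrier H. hinner H v w = (\<Sum>i\<in>I. hinner H (\<eta> i) w)" by blast
    with insert show ?case
      by (intro bexI[of _ "\<eta> i \<oplus> v"]) (auto simp: hinner_add_left)
  qed
  then obtain v where v: "v \<in> carrier H" "\<And>w. w \<in> carrier H \<Longrightarrow> hinner H v w = (\<Sum>i\<in>I. hinner H (\<eta> i) w)"
    by blast
  have "(\<Sum>j\<in>I. hinner H (\<eta> i) (\<eta> j)) = hinner H (\<eta> i) v" for i
  proof -
    have "hinner H (\<eta> i) v = cnj (\<Sum>j\<in>I. hinner H (\<eta> j) (\<eta> i))"
      using v \<eta> by (metis hinner_commute)
    also have "\<dots> = (\<Sum>j\<in>I. hinner H (\<eta> i) (\<eta> j))"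
      unfolding cnj_sum using \<eta> by (intro sum.cong refl) (metis hinner_commute)
    finally show ?thesis ..
  qed
  hence "(\<Sum>i\<in>I. \<Sum>j\<in>I. hinner H (\<eta> i) (\<eta> j)) = hinner H v v"
    using v by simp
  thus "0 \<le> Re (\<Sum>i\<in>I. \<Sum>j\<in>I. hinner H (\<eta> i) (\<eta> j))"
    using hinner_self_nonneg[OF v(1)] by simp
qed

text \<open>Polarization: the form is real at \<xi> \<oplus> \<eta>, which settles the imaginary
  parts, and at \<xi> \<oplus> \<i> \<odot> \<eta>, which settles the real parts.\<close>

lemma positive_op_symmetric:
  assumes "positive_op H T" "\<xi> \<in> carrier H" "\<eta> \<in> carrier H"
  shows "hinner H (T \<xi>) \<eta> = hinner H \<xi> (T \<eta>)"
proof -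
  have lin: "lin_op T" using assms(1) by (auto simp: positive_op_def bounded_op_def lin_op_def)
  have im: "Im (hinner H (T \<zeta>) \<zeta>) = 0" if "\<zeta> \<in> carrier H" for \<zeta>
    using assms(1) that by (simp add: positive_op_def complex_nonneg_Reals_iff)
  have "Im (hinner H (T \<xi>) \<eta> + hinner H (T \<eta>) \<xi>) = 0"
    using im[of "\<xi> \<oplus> \<eta>"] im[of \<xi>] im[of \<eta>] assms(2,3) lin
    by (simp add: lin_op_add hinner_add_left hinner_add_right)
  moreover have "Re (hinner H (T \<eta>) \<xi>) = Re (hinner H (T \<xi>) \<eta>)"
    using im[of "\<xi> \<oplus> \<i> \<odot> \<eta>"] im[of \<xi>] im[of \<eta>] assms(2,3) lin
    by (simp add: lin_op_add lin_op_smult hinner_add_left hinner_add_right hinner_smult_left hinner_smult_right)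
  ultimately have "hinner H (T \<xi>) \<eta> = cnj (hinner H (T \<eta>) \<xi>)"
    by (simp add: complex_eq_iff)
  thus ?thesis using assms(2,3) lin by (simp add: hinner_commute[of \<xi>])
qed

end

section \<open>A single quantum probability measure\<close>

locale hilbert_qpm = hilbert_space H for H :: "'v hilbert" (structure) +
  fixes M :: "'a::topological_space set \<Rightarrow> 'v \<Rightarrow> 'v"
  assumes qpm: "qpm H M"
begin

lemma qpm_lin [simp]: "\<alpha> \<in> sets borel \<Longrightarrow> lin_op (M \<alpha>)"
  using qpm by (auto simp: qpm_def positive_op_def bounded_op_def lin_op_def)

lemma qpm_symmetric:
  "\<alpha> \<in> sets borel \<Longrightarrow> \<xi> \<in> carrier H \<Longrightarrow> \<eta> \<in> carrier H \<Longrightarrow> hinner H (M \<alpha> \<xi>) \<eta> = hinner H \<xi> (M \<alpha> \<eta>)"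
  using qpm by (intro positive_op_symmetric) (auto simp: qpm_def)

lemma qpm_UNIV [simp]: "\<xi> \<in> carrier H \<Longrightarrow> M UNIV \<xi> = \<xi>"
  using qpm by (auto simp: qpm_def)

text \<open>Sequences with one nonzero entry turn the weak* functionals into single matrix
  coefficients.\<close>

lemma qpm_sums:
  assumes \<alpha>: "range \<alpha> \<subseteq> sets borel" "disjoint_family \<alpha>" and \<xi>: "\<xi> \<in> carrier H" and \<eta>: "\<eta> \<in> carrier H"
  shows "(\<lambda>i. hinner H (M (\<alpha> i) \<xi>) \<eta>) sums hinner H (M (\<Union>i. \<alpha> i) \<xi>) \<eta>"
proof -
  define s where "s \<zeta> n = (if n = 0 then \<zeta> else \<zero>)" for \<zeta> and n :: nat
  have sq: "square_summable H (s \<zeta>)" if "\<zeta> \<in> carrier H" for \<zeta>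
  proof -
    have "summable (\<lambda>n. (hnorm H (s \<zeta> n))\<^sup>2)"
      by (rule summable_finite[of "{0}"]) (auto simp: s_def hnorm_def)
    thus ?thesis using that by (auto simp: square_summable_def s_def)
  qed
  have eval: "(\<Sum>n. hinner H (T (s \<xi> n)) (s \<eta> n)) = hinner H (T \<xi>) \<eta>" if "lin_op T" for T
    using that by (subst suminf_finite[of "{0}"]) (auto simp: s_def)
  have "weak_star_sums H (\<lambda>i. M (\<alpha> i)) (M (\<Union>i. \<alpha> i))"
    using qpm \<alpha> by (auto simp: qpm_def)
  hence "(\<lambda>i. \<Sum>n. hinner H (M (\<alpha> i) (s \<xi> n)) (s \<eta> n)) sums (\<Sum>n. hinner H (M (\<Union>i. \<alpha> i) (s \<xi> n)) (s \<eta> n))"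
    using sq[OF \<xi>] sq[OF \<eta>] by (auto simp: weak_star_sums_def)
  moreover have "\<alpha> i \<in> sets borel" "(\<Union>i. \<alpha> i) \<in> sets borel" for i
    using \<alpha>(1) by auto
  ultimately show ?thesis by (simp add: eval)
qed

text \<open>The empty set, repeated, is a disjoint sequence, and a constant series converges only if
  its terms vanish.\<close>

lemma qpm_empty:
  assumes "\<xi> \<in> carrier H" "\<eta> \<in> carrier H"
  shows "hinner H (M {} \<xi>) \<eta> = 0"
  using sums_summable[OF qpm_sums[of "\<lambda>i. {}", OF _ _ assms]]
  by (simp add: disjoint_family_on_def summable_const_iff)

lemma qpm_Un:
  assumes "\<alpha> \<in> sets borel" "\<beta> \<in> sets borel" "\<alpha> \<inter> \<beta> = {}" "\<xi> \<in> carrier H" "\<eta> \<in> carrier H"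
  shows "hinner H (M (\<alpha> \<union> \<beta>) \<xi>) \<eta> = hinner H (M \<alpha> \<xi>) \<eta> + hinner H (M \<beta> \<xi>) \<eta>"
proof -
  have "disjoint_family (binaryset \<alpha> \<beta>)"
    using assms(3) by (auto simp: disjoint_family_on_def binaryset_def)
  hence "(\<lambda>i. hinner H (M (binaryset \<alpha> \<beta> i) \<xi>) \<eta>) sums hinner H (M (\<Union>i. binaryset \<alpha> \<beta> i) \<xi>) \<eta>"
    using assms by (intro qpm_sums) (auto simp: range_binaryset_eq)
  moreover have "(\<lambda>i. hinner H (M (binaryset \<alpha> \<beta> i) \<xi>) \<eta>) sums (hinner H (M \<alpha> \<xi>) \<eta> + hinner H (M \<beta> \<xi>) \<eta>)"
    using assms by (intro binaryset_sums) (simp add: qpm_empty)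
  ultimately show ?thesis by (simp add: UN_binaryset_eq sums_unique2)
qed

lemma qpm_finite_Union:
  assumes "finite J" "\<And>j. j \<in> J \<Longrightarrow> \<alpha> j \<in> sets borel" "disjoint_family_on \<alpha> J"
    and "\<xi> \<in> carrier H" "\<eta> \<in> carrier H"
  shows "hinner H (M (\<Union>j\<in>J. \<alpha> j) \<xi>) \<eta> = (\<Sum>j\<in>J. hinner H (M (\<alpha> j) \<xi>) \<eta>)"
  using assms
proof (induction J rule: finite_induct)
  case empty
  thus ?case by (simp add: qpm_empty)
next
  case (insert j J)
  have "\<alpha> j \<inter> (\<Union>i\<in>J. \<alpha> i) = {}"
    using insert by (auto simp: disjoint_family_on_def)
  moreover have "(\<Union>i\<in>J. \<alpha> i) \<in> sets borel"
    using insert by (intro sets.finite_UN) auto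
  moreover have "disjoint_family_on \<alpha> J"
    using insert by (auto simp: disjoint_family_on_def)
  ultimately show ?case using insert by (simp add: qpm_Un)
qed

lemma qpm_effect:
  assumes \<alpha>: "\<alpha> \<in> sets borel"
  shows "effect (M \<alpha>)"
proof -
  have pos: "0 \<le> Re (hinner H (M \<beta> \<xi>) \<xi>)" if "\<beta> \<in> sets borel" "\<xi> \<in> carrier H" for \<beta> \<xi>
    using qpm that by (auto simp: qpm_def positive_op_def complex_nonneg_Reals_iff)
  have "Re (hinner H (M \<alpha> \<xi>) \<xi>) \<le> Re (hinner H \<xi> \<xi>)" if \<xi>: "\<xi> \<in> carrier H" for \<xi>
  proof -
    have "hinner H (M \<alpha> \<xi>) \<xi> + hinner H (M (- \<alpha>) \<xi>) \<xi> = hinner H \<xi> \<xi>"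
      using qpm_Un[of \<alpha> "- \<alpha>" \<xi> \<xi>] \<alpha> \<xi> by (simp add: Compl_partition)
    from arg_cong[OF this, of Re] show ?thesis using pos[of "- \<alpha>" \<xi>] \<alpha> \<xi> by simp
  qed
  thus ?thesis
    using \<alpha> pos by (auto simp: effect_def qpm_symmetric)
qed

text \<open>
  The sum over the atoms \<open>a\<close> of the algebra generated by the \<open>\<alpha> i\<close> of the forms belonging to \<open>M a\<close>,
  evaluated at the vectors \<open>1\<^bsub>a \<subseteq> \<alpha> i\<^esub> \<eta> i - M (\<alpha> i) (\<eta> i)\<close>, is the difference of both sides.
\<close>

lemma psd_ops_qpm_defect:
  assumes \<alpha>: "\<And>i. \<alpha> i \<in> sets borel" and T: "\<And>i j. lin_op (T i j)"
    and comm: "\<And>i j \<beta> \<xi>. \<beta> \<in> sets borel \<Longrightarrow> \<xi> \<in> carrier H \<Longrightarrow> T i j (M \<beta> \<xi>) = M \<beta> (T i j \<xi>)"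
    and psd: "psd_ops T" and I: "finite I" and \<eta>: "\<And>i. \<eta> i \<in> carrier H"
  shows "Re (\<Sum>i\<in>I. \<Sum>j\<in>I. hinner H (T i j (M (\<alpha> i) (\<eta> i))) (M (\<alpha> j) (\<eta> j))) \<le>
    Re (\<Sum>i\<in>I. \<Sum>j\<in>I. hinner H (M (\<alpha> i \<inter> \<alpha> j) (T i j (\<eta> i))) (\<eta> j))"
proof -
  \<comment> \<open>\<open>a J\<close> is the atom of the points that lie in exactly those \<alpha>
    i with i in \<open>J\<close>.\<close>
  define a where "a J = {x. \<forall>i\<in>I. x \<in> \<alpha> i \<longleftrightarrow> i \<in> J}" for J
  have a_eq: "a J = (\<Inter>i\<in>I. if i \<in> J then \<alpha> i else - \<alpha> i)" for J
    by (auto simp: a_def split: if_splits)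
  have a [simp]: "a J \<in> sets borel" for J
  proof (cases "I = {}")
    case False
    thus ?thesis unfolding a_eq using \<alpha> by (intro sets.finite_INT I) simp_all
  qed (simp add: a_eq)
  have disj: "disjoint_family_on a \<J>" if "\<J> \<subseteq> Pow I" for \<J>
    using that by (fastforce simp: disjoint_family_on_def a_def)
  have atoms: "hinner H (M \<beta> \<xi>) \<zeta> = (\<Sum>J\<in>Pow I. if P J then hinner H (M (a J) \<xi>) \<zeta> else 0)"
    if \<beta>: "\<beta> = {x. P {i \<in> I. x \<in> \<alpha> i}}" and "\<xi> \<in> carrier H" "\<zeta> \<in> carrier H" for \<beta> P \<xi> \<zeta>
  proof -
    let ?\<J> = "{J \<in> Pow I. P J}"
    have "x \<in> a {i \<in> I. x \<in> \<alpha> i}" for x by (auto simp: a_def)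
    moreover have "{i \<in> I. x \<in> \<alpha> i} = J" if "x \<in> a J" "J \<subseteq> I" for x J
      using that by (auto simp: a_def)
    ultimately have "\<beta> = (\<Union>J\<in>?\<J>. a J)" unfolding \<beta> by blast
    hence "hinner H (M \<beta> \<xi>) \<zeta> = (\<Sum>J\<in>?\<J>. hinner H (M (a J) \<xi>) \<zeta>)"
      using I that by (simp only:) (intro qpm_finite_Union disj; auto)
    thus ?thesis using I by (simp only: sum.inter_filter finite_Pow_iff)
  qed
  let ?E = "\<lambda>i. M (\<alpha> i)"
  \<comment> \<open>In the Naimark dilation, realised by \<open>H\<close>-valued functions with
    \<open>M\<close> as weight, this is the value on \<open>a J\<close> of P(\<alpha> i) V (\<eta>
    i) minus its projection to the range of V.\<close>
  define v where "v J i = (if i \<in> J then \<eta> i else \<zero>) \<ominus> ?E i (\<eta> i)" for J i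
  have E: "?E i (\<eta> i) \<in> carrier H" for i using \<alpha> \<eta> by simp
  have v: "v J i \<in> carrier H" for J i using \<eta> E by (simp add: v_def)
  have T0: "T i j \<zero> = \<zero>" for i j
    using lin_op_diff[OF T, of \<zero> \<zero> i j] T by (metis minus_equality r_neg a_minus_def zero_closed lin_op_closed)
  have M0: "M (a J) \<zero> = \<zero>" for J
    using lin_op_diff[OF qpm_lin[OF a], of \<zero> \<zero> J] by (metis r_neg a_minus_def zero_closed lin_op_closed qpm_lin a)
  \<comment> \<open>The trivial condition in the last summand gives it the shape of
    \<open>atoms\<close> for the set \<open>UNIV\<close>.\<close>
  have expand: "hinner H (M (a J) (T i j (v J i))) (v J j) =
      (if i \<in> J \<and> j \<in> J then hinner H (M (a J) (T i j (\<eta> i))) (\<eta> j) else 0)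
      - (if i \<in> J then hinner H (M (a J) (T i j (\<eta> i))) (?E j (\<eta> j)) else 0)
      - (if j \<in> J then hinner H (M (a J) (T i j (?E i (\<eta> i)))) (\<eta> j) else 0)
      + (if True then hinner H (M (a J) (T i j (?E i (\<eta> i)))) (?E j (\<eta> j)) else 0)" for i j J
    using T \<eta> E
    by (cases "i \<in> J"; cases "j \<in> J")
       (simp_all add: v_def lin_op_diff[OF T] lin_op_diff[OF qpm_lin] hinner_diff_left hinner_diff_right T0 M0)
  have sum_atoms: "(\<Sum>J\<in>Pow I. hinner H (M (a J) (T i j (v J i))) (v J j)) =
      hinner H (M (\<alpha> i \<inter> \<alpha> j) (T i j (\<eta> i))) (\<eta> j) - hinner H (T i j (?E i (\<eta> i))) (?E j (\<eta> j))"
    if "i \<in> I" "j \<in> I" for i j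
  proof -
    have Tc: "T i j (\<eta> i) \<in> carrier H" "T i j (?E i (\<eta> i)) \<in> carrier H" using T \<eta> E by auto
    have sets: "\<alpha> i \<inter> \<alpha> j = {x. i \<in> {i \<in> I. x \<in> \<alpha> i} \<and> j \<in> {i \<in> I. x \<in> \<alpha> i}}"
        "\<alpha> i = {x. i \<in> {i \<in> I. x \<in> \<alpha> i}}" "\<alpha> j = {x. j \<in> {i \<in> I. x \<in> \<alpha> i}}" "UNIV = {x. True}"
      using that by auto
    have "(\<Sum>J\<in>Pow I. hinner H (M (a J) (T i j (v J i))) (v J j)) =
      hinner H (M (\<alpha> i \<inter> \<alpha> j) (T i j (\<eta> i))) (\<eta> j) - hinner H (?E i (T i j (\<eta> i))) (?E j (\<eta> j))
      - hinner H (?E j (T i j (?E i (\<eta> i)))) (\<eta> j) + hinner H (M UNIV (T i j (?E i (\<eta> i)))) (?E j (\<eta> j))"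
      unfolding expand sum.distrib sum_subtractf
      by (simp only: atoms[OF sets(1) Tc(1) \<eta>] atoms[OF sets(2) Tc(1) E] atoms[OF sets(3) Tc(2) \<eta>]
          atoms[OF sets(4) Tc(2) E])
    also have "hinner H (?E i (T i j (\<eta> i))) (?E j (\<eta> j)) = hinner H (T i j (?E i (\<eta> i))) (?E j (\<eta> j))"
      using comm \<alpha> \<eta> by simp
    also have "hinner H (?E j (T i j (?E i (\<eta> i)))) (\<eta> j) = hinner H (T i j (?E i (\<eta> i))) (?E j (\<eta> j))"
      using \<alpha> Tc \<eta> by (simp add: qpm_symmetric)
    finally show ?thesis using Tc by simp
  qed
  have "0 \<le> Re (\<Sum>J\<in>Pow I. \<Sum>i\<in>I. \<Sum>j\<in>I. hinner H (M (a J) (T i j (v J i))) (v J j))"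
    unfolding Re_sum[of _ "Pow I"]
    by (intro sum_nonneg psd_opsD[OF psd_ops_effect_mult[OF qpm_effect[OF a] T comm[OF a] psd] I] v) auto
  also have "(\<Sum>J\<in>Pow I. \<Sum>i\<in>I. \<Sum>j\<in>I. hinner H (M (a J) (T i j (v J i))) (v J j)) =
    (\<Sum>i\<in>I. \<Sum>j\<in>I. \<Sum>J\<in>Pow I. hinner H (M (a J) (T i j (v J i))) (v J j))"
    by (subst sum.swap, intro sum.cong refl, subst sum.swap, rule refl)
  also have "\<dots> = (\<Sum>i\<in>I. \<Sum>j\<in>I. hinner H (M (\<alpha> i \<inter> \<alpha> j) (T i j (\<eta> i))) (\<eta> j)) -
      (\<Sum>i\<in>I. \<Sum>j\<in>I. hinner H (T i j (?E i (\<eta> i))) (?E j (\<eta> j)))"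
    by (simp add: sum_atoms sum_subtractf)
  finally show ?thesis by simp
qed

end

section \<open>The operator kernel of a channel\<close>

text \<open>The compression to \<open>H\<close> of P(\<alpha>'|x') P(\<alpha>|x) for s = (x,
  \<alpha>) and t = (x', \<alpha>'). For equal inputs the projections multiply; for different inputs
  only the component in \<open>H\<close> survives between them, so both factors are compressed
  separately.\<close>

definition channel_kernel :: "('x \<Rightarrow> 'a set \<Rightarrow> 'v \<Rightarrow> 'v) \<Rightarrow> 'x \<times> 'a set \<Rightarrow> 'x \<times> 'a set \<Rightarrow> 'v \<Rightarrow> 'v" where
  "channel_kernel E s t \<xi> = (if fst s = fst t then E (fst s) (snd s \<inter> snd t) \<xi>
     else E (fst t) (snd t) (E (fst s) (snd s) \<xi>))"

locale hilbert_channel = hilbert_space H for H :: "'v hilbert" (structure) +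
  fixes E :: "'x \<Rightarrow> 'a::topological_space set \<Rightarrow> 'v \<Rightarrow> 'v"
  assumes channel: "\<And>x. qpm H (E x)"
begin

sublocale hilbert_qpm H "E x" for x
  by unfold_locales (rule channel)

text \<open>Each spanning vector is split into its component \<open>v i\<close> in \<open>H\<close>
  and the rest. The components contribute the form of \<open>T\<close>; the rests are orthogonal for
  different inputs, so they contribute one block for each input, nonnegative by
  \<open>psd_ops_qpm_defect\<close>.\<close>

lemma psd_ops_channel_kernel:
  fixes T :: "'i \<Rightarrow> 'i \<Rightarrow> 'v \<Rightarrow> 'v"
  assumes s: "\<And>i. snd (s i) \<in> sets borel" and T: "\<And>i j. lin_op (T i j)"
    and comm: "\<And>i j x \<beta> \<xi>. \<beta> \<in> sets borel \<Longrightarrow> \<xi> \<in> carrier H \<Longrightarrow> T i j (E x \<beta> \<xi>) = E x \<beta> (T i j \<xi>)"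
    and psd: "psd_ops T"
  shows "psd_ops (\<lambda>i j \<xi>. channel_kernel E (s i) (s j) (T i j \<xi>))"
  unfolding psd_ops_def
proof (intro allI impI)
  fix I :: "'i set" and \<eta> :: "'i \<Rightarrow> 'v"
  assume I: "finite I" and "\<forall>i. \<eta> i \<in> carrier H"
  hence \<eta>: "\<eta> i \<in> carrier H" for i by blast
  let ?x = "\<lambda>i. fst (s i)" and ?\<alpha> = "\<lambda>i. snd (s i)"
  define v where "v i = E (?x i) (?\<alpha> i) (\<eta> i)" for i
  have v: "v i \<in> carrier H" for i using s \<eta> by (simp add: v_def)
  define D where "D i j = hinner H (E (?x i) (?\<alpha> i \<inter> ?\<alpha> j) (T i j (\<eta> i))) (\<eta> j) - hinner H (T i j (v i)) (v j)" for i j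
  define Ix where "Ix x = {i \<in> I. ?x i = x}" for x
  have ker: "hinner H (channel_kernel E (s i) (s j) (T i j (\<eta> i))) (\<eta> j) =
      hinner H (T i j (v i)) (v j) + (if ?x j = ?x i then D i j else 0)" for i j
    using s \<eta> T by (auto simp: channel_kernel_def D_def v_def comm qpm_symmetric)
  have "(\<Sum>i\<in>I. \<Sum>j\<in>I. if ?x j = ?x i then D i j else 0) = (\<Sum>i\<in>I. \<Sum>j\<in>Ix (?x i). D i j)"
    using I by (simp add: Ix_def sum.inter_filter)
  also have "\<dots> = (\<Sum>x\<in>?x ` I. \<Sum>i\<in>Ix x. \<Sum>j\<in>Ix (?x i). D i j)"
    unfolding Ix_def using I by (rule sum.image_gen)
  also have "\<dots> = (\<Sum>x\<in>?x ` I. \<Sum>i\<in>Ix x. \<Sum>j\<in>Ix x. D i j)"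
    by (intro sum.cong refl) (auto simp: Ix_def)
  finally have D: "(\<Sum>i\<in>I. \<Sum>j\<in>I. if ?x j = ?x i then D i j else 0) = (\<Sum>x\<in>?x ` I. \<Sum>i\<in>Ix x. \<Sum>j\<in>Ix x. D i j)" .
  have "0 \<le> Re (\<Sum>i\<in>Ix x. \<Sum>j\<in>Ix x. D i j)" for x
  proof -
    have "(\<Sum>i\<in>Ix x. \<Sum>j\<in>Ix x. D i j) =
      (\<Sum>i\<in>Ix x. \<Sum>j\<in>Ix x. hinner H (E x (?\<alpha> i \<inter> ?\<alpha> j) (T i j (\<eta> i))) (\<eta> j)) -
      (\<Sum>i\<in>Ix x. \<Sum>j\<in>Ix x. hinner H (T i j (E x (?\<alpha> i) (\<eta> i))) (E x (?\<alpha> j) (\<eta> j)))"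
      unfolding sum_subtractf[symmetric] by (intro sum.cong refl) (auto simp: Ix_def D_def v_def)
    thus ?thesis
      using psd_ops_qpm_defect[of ?\<alpha> T x "Ix x" \<eta>, OF s T comm psd _ \<eta>] I by (simp add: Ix_def)
  qed
  hence "0 \<le> Re (\<Sum>i\<in>I. \<Sum>j\<in>I. if ?x j = ?x i then D i j else 0)"
    unfolding D Re_sum[of _ "?x ` I"] by (intro sum_nonneg)
  moreover have "0 \<le> Re (\<Sum>i\<in>I. \<Sum>j\<in>I. hinner H (T i j (v i)) (v j))"
    by (rule psd_opsD[OF psd I v])
  ultimately show "0 \<le> Re (\<Sum>i\<in>I. \<Sum>j\<in>I. hinner H (channel_kernel E (s i) (s j) (T i j (\<eta> i))) (\<eta> j))"
    by (simp only: ker sum.distrib plus_complex.sel)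
qed

lemma lin_op_channel_kernel:
  assumes "snd s \<in> sets borel" "snd t \<in> sets borel"
  shows "lin_op (channel_kernel E s t)"
  using assms lin_op_comp[of "E (fst t) (snd t)" "E (fst s) (snd s)"]
  by (cases "fst s = fst t") (simp_all add: channel_kernel_def[abs_def])

lemma channel_kernel_adjoint:
  assumes "snd s \<in> sets borel" "snd t \<in> sets borel" "\<xi> \<in> carrier H" "\<eta> \<in> carrier H"
  shows "hinner H (channel_kernel E s t \<xi>) \<eta> = hinner H \<xi> (channel_kernel E t s \<eta>)"
  using assms by (auto simp: channel_kernel_def qpm_symmetric Int_commute)

end


section \<open>The dilation of a channel\<close>

lemma sum_list_nth: "(\<Sum>x\<leftarrow>xs. f x) = (\<Sum>i<length xs. f (xs ! i))"
  by (simp add: sum_list_sum_nth atLeast0LessThan)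

text \<open>Supplies the point mass part of the projection-valued measures.\<close>

lemma sums_of_bool_disjoint:
  assumes "disjoint_family \<alpha>"
  shows "(\<lambda>i. of_bool (a \<in> \<alpha> i) :: complex) sums of_bool (a \<in> (\<Union>i. \<alpha> i))"
proof (cases "a \<in> (\<Union>i. \<alpha> i)")
  case True
  then obtain i where "a \<in> \<alpha> i" by blast
  hence "(\<lambda>j. of_bool (a \<in> \<alpha> j)) = (\<lambda>j. if j = i then 1 else 0 :: complex)"
    using assms by (auto simp: fun_eq_iff disjoint_family_on_def)
  thus ?thesis using True sums_single[of i "\<lambda>_. 1 :: complex"] by simp
qed auto

lemma (in hilbert_channel) channel_kernel_UNIV_left:
  assumes "snd t \<in> sets borel" "\<xi> \<in> carrier H"
  shows "channel_kernel E (x, UNIV) t \<xi> = E (fst t) (snd t) \<xi>"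
  using assms by (simp add: channel_kernel_def)

lemma (in hilbert_channel) channel_kernel_UNIV_right:
  assumes "snd s \<in> sets borel" "\<xi> \<in> carrier H"
  shows "channel_kernel E s (x, UNIV) \<xi> = E (fst s) (snd s) \<xi>"
  using assms by (simp add: channel_kernel_def)

text \<open>
  An index \<open>s\<close> stands for the vector \<open>P(\<alpha>|x) Q V \<eta>\<close> of the dilation space, where \<open>(x, \<alpha>)\<close> is \<open>letter s\<close>,
  \<open>\<eta>\<close> is \<open>vec s\<close>, and the operator kernel \<open>T\<close>, whose values commute with \<open>E\<close>, encodes the inner
  products of the factors \<open>Q\<close>.
\<close>

locale channel_dilation = hilbert_channel H E
  for H :: "'v hilbert" (structure) and E :: "'x \<Rightarrow> 'a::topological_space set \<Rightarrow> 'v \<Rightarrow> 'v" +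
  fixes letter :: "'s \<Rightarrow> 'x \<times> 'a set" and vec :: "'s \<Rightarrow> 'v"
    and upd :: "'x \<times> 'a set \<Rightarrow> 'v \<Rightarrow> 's \<Rightarrow> 's"
    and T :: "'s \<Rightarrow> 's \<Rightarrow> 'v \<Rightarrow> 'v"
  assumes letter_borel [simp]: "snd (letter s) \<in> sets borel"
    and vec_closed [simp]: "vec s \<in> carrier H"
    and letter_upd [simp]: "snd a \<in> sets borel \<Longrightarrow> letter (upd a \<eta> s) = a"
    and vec_upd [simp]: "\<eta> \<in> carrier H \<Longrightarrow> vec (upd a \<eta> s) = \<eta>"
    and upd_upd [simp]: "upd a \<eta> (upd a' \<eta>' s) = upd a \<eta> s"
    and T_upd_left [simp]: "T (upd a \<eta> s) t = T s t"
    and T_upd_right [simp]: "T s (upd a \<eta> t) = T s t"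
    and T_lin [simp]: "lin_op (T s t)"
    and T_commute: "\<alpha> \<in> sets borel \<Longrightarrow> \<xi> \<in> carrier H \<Longrightarrow> T s t (E x \<alpha> \<xi>) = E x \<alpha> (T s t \<xi>)"
    and T_adjoint: "\<xi> \<in> carrier H \<Longrightarrow> \<eta> \<in> carrier H \<Longrightarrow> hinner H (T s t \<xi>) \<eta> = hinner H \<xi> (T t s \<eta>)"
    and T_psd: "\<And>\<sigma> :: nat \<Rightarrow> 's. psd_ops (\<lambda>i j. T (\<sigma> i) (\<sigma> j))"
begin

definition dil_kernel :: "'s \<Rightarrow> 's \<Rightarrow> complex" where
  "dil_kernel s t = hinner H (channel_kernel E (letter s) (letter t) (T s t (vec s))) (vec t)"

lemma T_channel_kernel:
  assumes "snd a \<in> sets borel" "snd b \<in> sets borel" "\<xi> \<in> carrier H"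
  shows "T s t (channel_kernel E a b \<xi>) = channel_kernel E a b (T s t \<xi>)"
  using assms by (simp add: channel_kernel_def T_commute)

sublocale psd_kernel dil_kernel
proof
  fix s t
  have "dil_kernel t s = hinner H (T t s (vec t)) (channel_kernel E (letter s) (letter t) (vec s))"
    by (simp add: dil_kernel_def channel_kernel_adjoint)
  also have "\<dots> = hinner H (vec t) (channel_kernel E (letter s) (letter t) (T s t (vec s)))"
    by (simp add: T_adjoint lin_op_channel_kernel T_channel_kernel)
  also have "\<dots> = cnj (dil_kernel s t)"
    unfolding dil_kernel_def by (intro hinner_commute) (simp_all add: lin_op_channel_kernel)
  finally show "dil_kernel t s = cnj (dil_kernel s t)" .
next
  fix u :: "(complex \<times> 's) list"
  \<comment> \<open>Positions in the list serve as indices, so repeated points are harmless; the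
    coefficients are absorbed into the vectors.\<close>
  define c where "c i = fst (u ! i)" for i
  define \<sigma> where "\<sigma> i = snd (u ! i)" for i
  define n where "n = length u"
  have "kform dil_kernel u u = (\<Sum>j<n. \<Sum>i<n. cnj (c j) * (c i * dil_kernel (\<sigma> i) (\<sigma> j)))"
    by (simp add: kform_def ev_def lin_comb_def sum_list_nth split_def c_def \<sigma>_def n_def sum_distrib_left)
  also have "\<dots> = (\<Sum>i<n. \<Sum>j<n. hinner H
      (channel_kernel E (letter (\<sigma> i)) (letter (\<sigma> j)) (T (\<sigma> i) (\<sigma> j) (c i \<odot> vec (\<sigma> i)))) (c j \<odot> vec (\<sigma> j)))"
    by (subst sum.swap) (simp add: dil_kernel_def lin_op_smult lin_op_channel_kernel
        hinner_smult_left hinner_smult_right mult_ac)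
  also have "0 \<le> Re \<dots>"
    by (intro psd_opsD[OF psd_ops_channel_kernel[where s = "\<lambda>i. letter (\<sigma> i)" and T = "\<lambda>i j. T (\<sigma> i) (\<sigma> j)"]])
       (simp_all add: T_commute T_psd)
  finally show "0 \<le> Re (kform dil_kernel u u)" .
qed

lemma kernel_upd_left:
  assumes "snd a \<in> sets borel" "\<eta> \<in> carrier H"
  shows "dil_kernel (upd a \<eta> s) t = hinner H (channel_kernel E a (letter t) (T s t \<eta>)) (vec t)"
  using assms by (simp add: dil_kernel_def)

lemma kernel_upd_right:
  assumes "snd a \<in> sets borel" "\<eta> \<in> carrier H"
  shows "dil_kernel s (upd a \<eta> t) = hinner H (channel_kernel E (letter s) a (T s t (vec s))) \<eta>"
  using assms by (simp add: dil_kernel_def)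

text \<open>Updating \<open>s\<close> with its own data may yield another index, but one that
  represents the same vector.\<close>

lemma kernel_upd_self: "dil_kernel (upd (letter s) (vec s) s) = dil_kernel s"
  by (simp add: fun_eq_iff kernel_upd_left, simp add: dil_kernel_def)

abbreviation ltr_op :: "'s \<Rightarrow> 'v \<Rightarrow> 'v" where
  "ltr_op s \<equiv> E (fst (letter s)) (snd (letter s))"

section \<open>The projection-valued measures on the dilation space\<close>

text \<open>
  On the part of the dilation space that is generated by channel inputs other than \<open>x\<close> and orthogonal to
  the range of \<open>V\<close>, the measure \<open>P(\<cdot>|x)\<close> is the point mass at \<open>undefined\<close>.
\<close>

definition proj :: "'x \<Rightarrow> 'a set \<Rightarrow> 's \<Rightarrow> (complex \<times> 's) list" where
  "proj x \<alpha> s = (if fst (letter s) = x then [(1, upd (x, \<alpha> \<inter> snd (letter s)) (vec s) s)]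
     else [(1, upd (x, \<alpha>) (ltr_op s (vec s)) s), (of_bool (undefined \<in> \<alpha>), s),
       (- of_bool (undefined \<in> \<alpha>), upd (x, UNIV) (ltr_op s (vec s)) s)])"

declare sets.Int [simp]

lemma lift_proj_same:
  "fst (letter s) = x \<Longrightarrow> lift (proj x \<alpha>) f s = f (upd (x, \<alpha> \<inter> snd (letter s)) (vec s) s)"
  by (simp add: lift_def proj_def)

text \<open>The vector of \<open>s\<close> has the component Q V \<eta> in the dilated copy of
  \<open>H\<close>, where \<eta> is \<open>ltr_op s (vec s)\<close>. The first term treats this
  component; the bracket is the orthogonal rest, on which the point mass acts. The index with
  \<open>UNIV\<close> represents Q V \<eta> itself.\<close>

lemma lift_proj_other:
  "fst (letter s) \<noteq> x \<Longrightarrow> lift (proj x \<alpha>) f s = f (upd (x, \<alpha>) (ltr_op s (vec s)) s) +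
     of_bool (undefined \<in> \<alpha>) * (f s - f (upd (x, UNIV) (ltr_op s (vec s)) s))"
  by (simp add: lift_def proj_def algebra_simps)

lemma lift_proj_kernel_other:
  assumes "\<alpha> \<in> sets borel" "fst (letter s) \<noteq> x" "fst (letter t) \<noteq> x"
  defines "z \<equiv> T s t (vec s)"
  shows "lift (proj x \<alpha>) (dil_kernel s) t = hinner H (E x \<alpha> (ltr_op s z)) (ltr_op t (vec t)) +
    of_bool (undefined \<in> \<alpha>) * (dil_kernel s t - hinner H (ltr_op s z) (ltr_op t (vec t)))"
  using assms by (simp add: lift_proj_other kernel_upd_right channel_kernel_def)

text \<open>Both sides are computed according to whether the inputs of \<open>s\<close> and
  \<open>t\<close> equal \<open>x\<close>. If exactly one does, \<open>dil_kernel s t\<close> is of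
  product form and the point mass terms cancel.\<close>

lemma lift_proj_symmetric:
  assumes \<alpha>: "\<alpha> \<in> sets borel"
  shows "lift (proj x \<alpha>) (dil_kernel s) t = cnj (lift (proj x \<alpha>) (dil_kernel t) s)"
proof -
  define z where "z = T s t (vec s)"
  have z: "z \<in> carrier H" by (simp add: z_def)
  have cnj_kernel: "cnj (dil_kernel t u) = dil_kernel u t" for u by (rule hermitian[symmetric])
  have T_ltr: "T s t (ltr_op s (vec s)) = ltr_op s z"
    by (simp add: T_commute z_def)
  have right: "cnj (lift (proj x \<alpha>) (dil_kernel t) s) =
    (if fst (letter s) = x then hinner H (channel_kernel E (x, \<alpha> \<inter> snd (letter s)) (letter t) z) (vec t)
     else hinner H (channel_kernel E (x, \<alpha>) (letter t) (ltr_op s z)) (vec t) +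
       of_bool (undefined \<in> \<alpha>) * (dil_kernel s t - hinner H (ltr_op t (ltr_op s z)) (vec t)))"
    using \<alpha> by (simp add: lift_proj_same lift_proj_other cnj_kernel kernel_upd_left T_ltr z
        z_def[symmetric] channel_kernel_UNIV_left)
  have left: "lift (proj x \<alpha>) (dil_kernel s) t =
    (if fst (letter t) = x then hinner H (channel_kernel E (letter s) (x, \<alpha> \<inter> snd (letter t)) z) (vec t)
     else hinner H (channel_kernel E (letter s) (x, \<alpha>) z) (ltr_op t (vec t)) +
       of_bool (undefined \<in> \<alpha>) * (dil_kernel s t - hinner H (ltr_op s z) (ltr_op t (vec t))))"
    using \<alpha> by (simp add: lift_proj_same lift_proj_other kernel_upd_right z z_def[symmetric] channel_kernel_UNIV_right)
  have st: "dil_kernel s t = hinner H (channel_kernel E (letter s) (letter t) z) (vec t)"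
    by (simp add: dil_kernel_def z_def)
  show ?thesis
  proof (cases "fst (letter s) = x"; cases "fst (letter t) = x")
    assume "fst (letter s) = x" "fst (letter t) = x"
    thus ?thesis
      unfolding left right by (simp add: channel_kernel_def Int_ac)
  next
    assume "fst (letter s) = x" "fst (letter t) \<noteq> x"
    thus ?thesis
      unfolding left right st using \<alpha> z by (simp add: channel_kernel_def qpm_symmetric Int_commute)
  next
    assume "fst (letter s) \<noteq> x" "fst (letter t) = x"
    thus ?thesis
      unfolding left right st using \<alpha> z by (simp add: channel_kernel_def)
  next
    assume "fst (letter s) \<noteq> x" "fst (letter t) \<noteq> x"
    thus ?thesis
      unfolding left right using \<alpha> z by (simp add: channel_kernel_def qpm_symmetric)
  qed
qed

text \<open>A substitution identity, valid for arbitrary functions: the second update overwrites the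
  first. Equal sets give idempotence.\<close>

lemma lift_proj_mult:
  assumes "\<alpha> \<in> sets borel" "\<beta> \<in> sets borel"
  shows "lift (proj x \<alpha>) (lift (proj x \<beta>) f) = lift (proj x (\<alpha> \<inter> \<beta>)) f"
proof
  fix s
  show "lift (proj x \<alpha>) (lift (proj x \<beta>) f) s = lift (proj x (\<alpha> \<inter> \<beta>)) f s"
  proof (cases "fst (letter s) = x")
    case True
    thus ?thesis using assms by (simp add: lift_proj_same Int_ac)
  next
    case False
    thus ?thesis using assms
      by (simp add: lift_proj_same lift_proj_other[of s x] Int_ac of_bool_conj algebra_simps)
  qed
qed

lemma symmetric_idem_proj: "\<alpha> \<in> sets borel \<Longrightarrow> symmetric_idem (proj x \<alpha>)"
  unfolding symmetric_idem_def using lift_proj_symmetric lift_proj_mult[of \<alpha> \<alpha> x]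
  by (metis Int_absorb)

text \<open>Membership in the space matters because only its elements are known to take equal values
  at indices that represent the same vector.\<close>

lemma lift_proj_UNIV:
  assumes f: "f \<in> kspace"
  shows "lift (proj x UNIV) f = f"
proof
  fix s
  show "lift (proj x UNIV) f s = f s"
  proof (cases "fst (letter s) = x")
    case True
    hence "lift (proj x UNIV) f s = f (upd (letter s) (vec s) s)"
      by (auto simp: lift_proj_same)
    also have "\<dots> = f s"
      using ev_cong_comb[OF f, of "[(1, upd (letter s) (vec s) s)]" "[(1, s)]"]
      by (simp add: kernel_upd_self)
    finally show ?thesis .
  qed (simp add: lift_proj_other)
qed

lemma kernel_upd_Un:
  assumes "\<alpha> \<in> sets borel" "\<beta> \<in> sets borel" "\<alpha> \<inter> \<beta> = {}" "\<eta> \<in> carrier H"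
  shows "dil_kernel (upd (x, \<alpha> \<union> \<beta>) \<eta> s) t = dil_kernel (upd (x, \<alpha>) \<eta> s) t + dil_kernel (upd (x, \<beta>) \<eta> s) t"
proof (cases "fst (letter t) = x")
  case True
  have "(\<alpha> \<inter> snd (letter t)) \<inter> (\<beta> \<inter> snd (letter t)) = {}" using assms(3) by blast
  thus ?thesis
    using assms True by (simp add: kernel_upd_left channel_kernel_def Int_Un_distrib2 qpm_Un)
next
  case False
  thus ?thesis
    using assms by (simp add: kernel_upd_left channel_kernel_def qpm_symmetric[of "snd (letter t)"] qpm_Un)
qed

lemma lift_proj_Un:
  assumes f: "f \<in> kspace" and \<alpha>: "\<alpha> \<in> sets borel" "\<beta> \<in> sets borel" "\<alpha> \<inter> \<beta> = {}"
  shows "lift (proj x (\<alpha> \<union> \<beta>)) f s = lift (proj x \<alpha>) f s + lift (proj x \<beta>) f s"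
proof -
  have f_Un: "f (upd (x, \<alpha> \<union> \<beta>) \<eta> s) = f (upd (x, \<alpha>) \<eta> s) + f (upd (x, \<beta>) \<eta> s)"
    if "\<alpha> \<in> sets borel" "\<beta> \<in> sets borel" "\<alpha> \<inter> \<beta> = {}" "\<eta> \<in> carrier H" for \<alpha> \<beta> \<eta>
    using ev_cong_comb[OF f, of "[(1, upd (x, \<alpha> \<union> \<beta>) \<eta> s)]" "[(1, upd (x, \<alpha>) \<eta> s), (1, upd (x, \<beta>) \<eta> s)]"]
    by (simp add: kernel_upd_Un[OF that] fun_eq_iff)
  show ?thesis
  proof (cases "fst (letter s) = x")
    case True
    have "(\<alpha> \<inter> snd (letter s)) \<inter> (\<beta> \<inter> snd (letter s)) = {}" using \<alpha>(3) by blast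
    thus ?thesis using True \<alpha> by (simp add: lift_proj_same Int_Un_distrib2 f_Un)
  next
    case False
    have "of_bool (undefined \<in> \<alpha> \<union> \<beta>) = (of_bool (undefined \<in> \<alpha>) + of_bool (undefined \<in> \<beta>) :: complex)"
      using \<alpha>(3) by auto
    thus ?thesis using False \<alpha> by (simp only: lift_proj_other[OF False]) (simp add: f_Un algebra_simps)
  qed
qed

lemma lift_proj_finite_Union:
  fixes \<alpha> :: "nat \<Rightarrow> 'a set"
  assumes f: "f \<in> kspace" and \<alpha>: "range \<alpha> \<subseteq> sets borel" "disjoint_family \<alpha>"
  shows "lift (proj x (\<Union>i<n. \<alpha> i)) f s = (\<Sum>i<n. lift (proj x (\<alpha> i)) f s)"
proof (induction n)
  case 0
  \<comment> \<open>Additivity for \<open>{} \<union> {}\<close> makes the value equal to twice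
    itself.\<close>
  show ?case using lift_proj_Un[OF f, of "{}" "{}" x s] by simp
next
  case (Suc n)
  have "(\<Union>i<n. \<alpha> i) \<in> sets borel" using \<alpha>(1) by (intro sets.finite_UN) auto
  moreover have "\<alpha> n \<inter> \<alpha> i = {}" if "i < n" for i
    using disjoint_family_onD[OF \<alpha>(2), of n i] that by simp
  hence "\<alpha> n \<inter> (\<Union>i<n. \<alpha> i) = {}" by blast
  ultimately show ?case
    using Suc \<alpha>(1) by (simp add: lessThan_Suc lift_proj_Un[OF f] image_subset_iff)
qed

lemma kernel_upd_sums:
  assumes \<alpha>: "range \<alpha> \<subseteq> sets borel" "disjoint_family \<alpha>" and \<eta>: "\<eta> \<in> carrier H"
  shows "(\<lambda>i. dil_kernel (upd (x, \<alpha> i) \<eta> s) t) sums dil_kernel (upd (x, \<Union>i. \<alpha> i) \<eta> s) t"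
proof -
  have \<alpha>_borel: "\<alpha> i \<in> sets borel" "(\<Union>i. \<alpha> i) \<in> sets borel" for i using \<alpha>(1) by auto
  show ?thesis
  proof (cases "fst (letter t) = x")
    case True
    have "(\<lambda>i. hinner H (E x (\<alpha> i \<inter> snd (letter t)) (T s t \<eta>)) (vec t)) sums
        hinner H (E x (\<Union>i. \<alpha> i \<inter> snd (letter t)) (T s t \<eta>)) (vec t)"
      using \<alpha> \<eta> by (intro qpm_sums) (auto simp: disjoint_family_on_def)
    thus ?thesis using True \<alpha>_borel \<eta> by (simp add: kernel_upd_left channel_kernel_def)
  next
    case False
    have "(\<lambda>i. hinner H (E x (\<alpha> i) (T s t \<eta>)) (ltr_op t (vec t))) sums
        hinner H (E x (\<Union>i. \<alpha> i) (T s t \<eta>)) (ltr_op t (vec t))"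
      using \<eta> by (intro qpm_sums \<alpha>) auto
    thus ?thesis
      using False \<alpha>_borel \<eta>
      by (simp add: kernel_upd_left channel_kernel_def qpm_symmetric[of "snd (letter t)"])
  qed
qed

lemma lift_proj_kernel_sums:
  assumes \<alpha>: "range \<alpha> \<subseteq> sets borel" "disjoint_family \<alpha>"
  shows "(\<lambda>i. lift (proj x (\<alpha> i)) (dil_kernel s) t) sums lift (proj x (\<Union>i. \<alpha> i)) (dil_kernel s) t"
proof -
  have \<alpha>_borel: "\<alpha> i \<in> sets borel" "(\<Union>i. \<alpha> i) \<in> sets borel" for i using \<alpha>(1) by auto
  note eq = lift_kernel[OF symmetric_idem_proj[OF \<alpha>_borel(1)]] lift_kernel[OF symmetric_idem_proj[OF \<alpha>_borel(2)]]
  show ?thesis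
  proof (cases "fst (letter s) = x")
    case True
    have "(\<lambda>i. dil_kernel (upd (x, \<alpha> i \<inter> snd (letter s)) (vec s) s) t) sums
        dil_kernel (upd (x, \<Union>i. \<alpha> i \<inter> snd (letter s)) (vec s) s) t"
      using \<alpha> by (intro kernel_upd_sums) (auto simp: disjoint_family_on_def)
    thus ?thesis using True by (simp add: eq proj_def)
  next
    case False
    let ?v = "ltr_op s (vec s)" and ?w = "undefined :: 'a"
    have "(\<lambda>i. dil_kernel (upd (x, \<alpha> i) ?v s) t + of_bool (?w \<in> \<alpha> i) * (dil_kernel s t - dil_kernel (upd (x, UNIV) ?v s) t))
      sums (dil_kernel (upd (x, \<Union>i. \<alpha> i) ?v s) t +
        of_bool (?w \<in> (\<Union>i. \<alpha> i)) * (dil_kernel s t - dil_kernel (upd (x, UNIV) ?v s) t))"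
      using \<alpha> by (intro sums_add sums_mult2 kernel_upd_sums sums_of_bool_disjoint) auto
    thus ?thesis using False by (simp add: eq proj_def algebra_simps del: UN_iff)
  qed
qed

lemma qpm_lift_proj: "qpm rkhs (\<lambda>\<alpha>. lift (proj x \<alpha>))"
  unfolding qpm_def
proof (intro conjI allI impI ballI)
  fix \<alpha> :: "'a set" assume "\<alpha> \<in> sets borel"
  thus "positive_op rkhs (lift (proj x \<alpha>))"
    by (intro positive_op_lift symmetric_idem_proj)
next
  fix f assume "f \<in> carrier rkhs"
  thus "lift (proj x UNIV) f = f" by (simp add: lift_proj_UNIV)
next
  fix \<alpha> :: "nat \<Rightarrow> 'a set" assume "range \<alpha> \<subseteq> sets borel \<and> disjoint_family \<alpha>"
  hence \<alpha>: "range \<alpha> \<subseteq> sets borel" "disjoint_family \<alpha>" by auto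
  show "weak_star_sums rkhs (\<lambda>i. lift (proj x (\<alpha> i))) (lift (proj x (\<Union>i. \<alpha> i)))"
  \<comment> \<open>The partial sums are the projections of the finite unions, hence
    contractions.\<close>
  proof (rule weak_star_sums_lift[where q = "\<lambda>n. proj x (\<Union>i<n. \<alpha> i)"])
    show "lift (proj x (\<Union>i<n. \<alpha> i)) f t = (\<Sum>i<n. lift (proj x (\<alpha> i)) f t)" if "f \<in> kspace" for f n t
      by (rule lift_proj_finite_Union[OF that \<alpha>])
    show "(\<lambda>n. lift (proj x (\<Union>i<n. \<alpha> i)) (dil_kernel s) t) \<longlonglongrightarrow> lift (proj x (\<Union>i. \<alpha> i)) (dil_kernel s) t" for s t
      using lift_proj_kernel_sums[OF \<alpha>] by (simp add: lift_proj_finite_Union[OF kernel_kspace \<alpha>] sums_def)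
  qed (use \<alpha>(1) in \<open>auto intro!: symmetric_idem_proj sets.countable_UN'\<close>)
qed

text \<open>
  Off the finitely many inputs that occur in \<open>s\<close> and \<open>t\<close>, the matrix coefficient is a coefficient
  of \<open>E(\<alpha>|x)\<close> up to a constant.
\<close>

lemma hinner_lift_proj_measurable:
  assumes meas: "\<And>\<xi> \<eta>. \<xi> \<in> carrier H \<Longrightarrow> \<eta> \<in> carrier H \<Longrightarrow> (\<lambda>x. hinner H (E x \<alpha> \<xi>) \<eta>) \<in> borel_measurable M"
    and points: "\<And>x. {x} \<in> sets M" and \<alpha>: "\<alpha> \<in> sets borel" and f: "f \<in> kspace" and g: "g \<in> kspace"
  shows "(\<lambda>x. hinner rkhs (lift (proj x \<alpha>) f) g) \<in> borel_measurable M"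
proof -
  have "(\<lambda>x. lift (proj x \<alpha>) (dil_kernel s) t) \<in> borel_measurable M" for s t
  proof (rule measurable_discrete_difference)
    let ?z = "T s t (vec s)"
    show "(\<lambda>x. hinner H (E x \<alpha> (ltr_op s ?z)) (ltr_op t (vec t)) +
      of_bool (undefined \<in> \<alpha>) * (dil_kernel s t - hinner H (ltr_op s ?z) (ltr_op t (vec t)))) \<in> borel_measurable M"
      by (intro borel_measurable_add meas borel_measurable_const) auto
    show "countable {fst (letter s), fst (letter t)}" by simp
  qed (use \<alpha> in \<open>auto simp: points lift_proj_kernel_other\<close>)
  hence "(\<lambda>x. ip (lift (proj x \<alpha>) f) g) \<in> borel_measurable M"
    by (intro ip_lift_measurable symmetric_idem_proj \<alpha> f g)
  thus ?thesis
    by (simp add: rkhs_hinner lift_kspace[OF symmetric_idem_proj[OF \<alpha>]] f g)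
qed

text \<open>A letter with the set \<open>UNIV\<close> acts as the identity whatever its input, so
  P(\<alpha>|x) merely replaces it; the two point mass terms cancel.\<close>

lemma lift_proj_kernel_UNIV:
  assumes \<alpha>: "\<alpha> \<in> sets borel" and s: "snd (letter s) = UNIV"
  shows "lift (proj x \<alpha>) (dil_kernel s) = dil_kernel (upd (x, \<alpha>) (vec s) s)"
proof -
  have "dil_kernel s t = dil_kernel (upd (x, UNIV) (vec s) s) t" for t
    using s channel_kernel_UNIV_left[of "letter t" "T s t (vec s)"]
    by (cases "letter s") (simp add: kernel_upd_left dil_kernel_def)
  thus ?thesis
    using s unfolding lift_kernel[OF symmetric_idem_proj[OF \<alpha>]] by (auto simp: proj_def fun_eq_iff)
qed

end


section \<open>Two commuting channels\<close>

lemma (in hilbert_channel) channel_kernel_commute: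
  assumes "lin_op S" "\<And>x \<alpha> \<xi>. \<alpha> \<in> sets borel \<Longrightarrow> \<xi> \<in> carrier H \<Longrightarrow> S (E x \<alpha> \<xi>) = E x \<alpha> (S \<xi>)"
    and "snd a \<in> sets borel" "snd b \<in> sets borel" "\<xi> \<in> carrier H"
  shows "S (channel_kernel E a b \<xi>) = channel_kernel E a b (S \<xi>)"
  using assms by (simp add: channel_kernel_def)

section \<open>Words as common indices of both dilations\<close>

type_synonym ('x, 'a, 'y, 'b, 'h) word = "('x \<times> 'a set + 'y \<times> 'b set) list \<times> 'h"

text \<open>Every word receives a meaning: the default set \<open>UNIV\<close> stands for the
  identity, so malformed words represent vectors that proper ones represent already, and the
  assumptions of \<open>channel_dilation\<close> hold for all words.\<close>

definition first_letter :: "('x, 'a::topological_space, 'y, 'b, 'h) word \<Rightarrow> 'x \<times> 'a set" where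
  "first_letter s = (case fst s of
     Inl (x, \<alpha>) # _ \<Rightarrow> (x, if \<alpha> \<in> sets borel then \<alpha> else UNIV) | _ \<Rightarrow> (undefined, UNIV))"

definition second_letter :: "('x, 'a, 'y, 'b::topological_space, 'h) word \<Rightarrow> 'y \<times> 'b set" where
  "second_letter s = (case fst s of
     _ # Inr (y, \<beta>) # _ \<Rightarrow> (y, if \<beta> \<in> sets borel then \<beta> else UNIV) | _ \<Rightarrow> (undefined, UNIV))"

definition word_vec :: "'h hilbert \<Rightarrow> ('x, 'a, 'y, 'b, 'h) word \<Rightarrow> 'h" where
  "word_vec H s = (if snd s \<in> carrier H then snd s else \<zero>\<^bsub>H\<^esub>)"

text \<open>The word is rebuilt with both letters. After one update it is in normal form, so updates
  of the two letters in either order end in the same word.\<close>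

definition set_first :: "'x \<times> 'a set \<Rightarrow> 'h \<Rightarrow> ('x, 'a, 'y, 'b::topological_space, 'h) word \<Rightarrow> ('x, 'a, 'y, 'b, 'h) word" where
  "set_first a \<eta> s = ([Inl a, Inr (second_letter s)], \<eta>)"

definition set_second :: "'y \<times> 'b set \<Rightarrow> 'h \<Rightarrow> ('x, 'a::topological_space, 'y, 'b, 'h) word \<Rightarrow> ('x, 'a, 'y, 'b, 'h) word" where
  "set_second b \<eta> s = ([Inl (first_letter s), Inr b], \<eta>)"

lemma first_letter_borel [simp]: "snd (first_letter s) \<in> sets borel"
  by (simp add: first_letter_def split: list.split sum.split)

lemma second_letter_borel [simp]: "snd (second_letter s) \<in> sets borel"
  by (simp add: second_letter_def split: list.split sum.split)

lemma first_letter_set_first [simp]: "snd a \<in> sets borel \<Longrightarrow> first_letter (set_first a \<eta> s) = a"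
  by (cases a) (simp add: first_letter_def set_first_def)

lemma second_letter_set_second [simp]: "snd b \<in> sets borel \<Longrightarrow> second_letter (set_second b \<eta> s) = b"
  by (cases b) (simp add: second_letter_def set_second_def)

lemma second_letter_set_first [simp]: "second_letter (set_first a \<eta> s) = second_letter s"
  using second_letter_borel[of s]
  by (cases "second_letter s") (simp add: set_first_def second_letter_def[of "([Inl a, Inr p], \<eta>)" for p])

lemma first_letter_set_second [simp]: "first_letter (set_second b \<eta> s) = first_letter s"
  using first_letter_borel[of s]
  by (cases "first_letter s") (simp add: set_second_def first_letter_def[of "([Inl p, Inr b], \<eta>)" for p])

lemma set_first_set_first [simp]: "set_first a \<eta> (set_first a' \<eta>' s) = set_first a \<eta> s"
  by (subst (1 3) set_first_def) simp

lemma set_second_set_second [simp]: "set_second b \<eta> (set_second b' \<eta>' s) = set_second b \<eta> s"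
  by (subst (1 3) set_second_def) simp

lemma set_first_set_second:
  "snd b \<in> sets borel \<Longrightarrow> set_first a \<eta> (set_second b \<eta>' s) = ([Inl a, Inr b], \<eta>)"
  by (simp add: set_first_def)

lemma set_second_set_first:
  "snd a \<in> sets borel \<Longrightarrow> set_second b \<eta> (set_first a \<eta>' s) = ([Inl a, Inr b], \<eta>)"
  by (simp add: set_second_def)

lemma word_vec_set_first [simp]: "\<eta> \<in> carrier H \<Longrightarrow> word_vec H (set_first a \<eta> s) = \<eta>"
  by (simp add: word_vec_def set_first_def)

lemma word_vec_set_second [simp]: "\<eta> \<in> carrier H \<Longrightarrow> word_vec H (set_second b \<eta> s) = \<eta>"
  by (simp add: word_vec_def set_second_def)

locale commuting_channels = E: hilbert_channel H E + F: hilbert_channel H F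
  for H :: "'h hilbert" (structure)
    and E :: "'x \<Rightarrow> 'a::topological_space set \<Rightarrow> 'h \<Rightarrow> 'h"
    and F :: "'y \<Rightarrow> 'b::topological_space set \<Rightarrow> 'h \<Rightarrow> 'h" +
  assumes commute: "\<alpha> \<in> sets borel \<Longrightarrow> \<beta> \<in> sets borel \<Longrightarrow> \<xi> \<in> carrier H \<Longrightarrow>
    E x \<alpha> (F y \<beta> \<xi>) = F y \<beta> (E x \<alpha> \<xi>)"
begin

abbreviation kernel_E :: "('x, 'a, 'y, 'b, 'h) word \<Rightarrow> ('x, 'a, 'y, 'b, 'h) word \<Rightarrow> 'h \<Rightarrow> 'h" where
  "kernel_E s t \<equiv> channel_kernel E (first_letter s) (first_letter t)"

abbreviation kernel_F :: "('x, 'a, 'y, 'b, 'h) word \<Rightarrow> ('x, 'a, 'y, 'b, 'h) word \<Rightarrow> 'h \<Rightarrow> 'h" where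
  "kernel_F s t \<equiv> channel_kernel F (second_letter s) (second_letter t)"

lemma word_vec_closed [simp]: "word_vec H s \<in> carrier H"
  by (simp add: word_vec_def)

lemma kernel_F_commute:
  "\<alpha> \<in> sets borel \<Longrightarrow> \<xi> \<in> carrier H \<Longrightarrow> kernel_F s t (E x \<alpha> \<xi>) = E x \<alpha> (kernel_F s t \<xi>)"
  by (rule F.channel_kernel_commute[symmetric]) (simp_all add: commute)

lemma kernel_E_commute:
  "\<beta> \<in> sets borel \<Longrightarrow> \<xi> \<in> carrier H \<Longrightarrow> kernel_E s t (F y \<beta> \<xi>) = F y \<beta> (kernel_E s t \<xi>)"
  by (rule E.channel_kernel_commute[symmetric]) (simp_all add: commute)

lemma kernels_commute:
  "\<xi> \<in> carrier H \<Longrightarrow> kernel_E s t (kernel_F s' t' \<xi>) = kernel_F s' t' (kernel_E s t \<xi>)"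
  by (rule F.channel_kernel_commute) (simp_all add: E.lin_op_channel_kernel kernel_E_commute)

text \<open>The parameter \<open>T\<close> is the kernel of \<open>F\<close>; its positivity is
  \<open>psd_ops_channel_kernel\<close> over the identity kernel.\<close>

sublocale P: channel_dilation H E first_letter "word_vec H" set_first kernel_F
proof
  show "E.psd_ops (\<lambda>i j. kernel_F (\<sigma> i) (\<sigma> j))" for \<sigma> :: "nat \<Rightarrow> ('x, 'a, 'y, 'b, 'h) word"
    using F.psd_ops_channel_kernel[of "\<lambda>i. second_letter (\<sigma> i)" "\<lambda>i j \<xi>. \<xi>"]
    by (simp add: E.lin_op_id E.psd_ops_id)
qed (simp_all add: kernel_F_commute F.lin_op_channel_kernel F.channel_kernel_adjoint)

sublocale Q: channel_dilation H F second_letter "word_vec H" set_second kernel_E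
proof
  show "E.psd_ops (\<lambda>i j. kernel_E (\<sigma> i) (\<sigma> j))" for \<sigma> :: "nat \<Rightarrow> ('x, 'a, 'y, 'b, 'h) word"
    using E.psd_ops_channel_kernel[of "\<lambda>i. first_letter (\<sigma> i)" "\<lambda>i j \<xi>. \<xi>"]
    by (simp add: E.lin_op_id E.psd_ops_id)
qed (simp_all add: kernel_E_commute E.lin_op_channel_kernel E.channel_kernel_adjoint)

text \<open>The two instances take the same product of kernels in opposite order, so both families
  of projections act on one Hilbert space.\<close>

lemma dil_kernels_eq: "Q.dil_kernel = P.dil_kernel"
  by (simp add: fun_eq_iff P.dil_kernel_def Q.dil_kernel_def kernels_commute)

text \<open>The two substitutions change different letters, and they change the vector by operators
  of \<open>E\<close> and of \<open>F\<close>, which commute.\<close>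

lemma lift_proj_commute:
  assumes "\<alpha> \<in> sets borel" "\<beta> \<in> sets borel"
  shows "P.lift (P.proj x \<alpha>) (P.lift (Q.proj y \<beta>) f) = P.lift (Q.proj y \<beta>) (P.lift (P.proj x \<alpha>) f)"
proof
  fix s
  show "P.lift (P.proj x \<alpha>) (P.lift (Q.proj y \<beta>) f) s = P.lift (Q.proj y \<beta>) (P.lift (P.proj x \<alpha>) f) s"
    using assms
    by (cases "fst (first_letter s) = x"; cases "fst (second_letter s) = y")
       (simp_all add: P.lift_def P.proj_def Q.proj_def set_first_set_second set_second_set_first
         commute algebra_simps)
qed

text \<open>Both sets are \<open>UNIV\<close>, so the inputs are immaterial and the index represents
  V \<xi>.\<close>

definition embed :: "'h \<Rightarrow> ('x, 'a, 'y, 'b, 'h) dilation_vector" where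
  "embed \<xi> = P.dil_kernel ([Inl (undefined, UNIV), Inr (undefined, UNIV)], \<xi>)"

lemma embed_simps:
  assumes "\<xi> \<in> carrier H"
  defines "s \<equiv> ([Inl (undefined, UNIV), Inr (undefined, UNIV)], \<xi>) :: ('x, 'a, 'y, 'b, 'h) word"
  shows "first_letter s = (undefined, UNIV)" "second_letter s = (undefined, UNIV)" "word_vec H s = \<xi>"
  using assms by (simp_all add: first_letter_def second_letter_def word_vec_def)

lemma isometry_embed: "isometry_op H P.rkhs embed"
proof -
  have val: "embed \<xi> t = hinner H (ch_E (ch_F \<xi>)) (word_vec H t)"
    if "\<xi> \<in> carrier H" "ch_E = E (fst (first_letter t)) (snd (first_letter t))"
      "ch_F = F (fst (second_letter t)) (snd (second_letter t))" for \<xi> t ch_E ch_F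
    using that
    by (simp add: embed_def P.dil_kernel_def embed_simps E.channel_kernel_UNIV_left F.channel_kernel_UNIV_left)
  have mem: "embed \<xi> \<in> P.kspace" for \<xi> by (simp add: embed_def)
  have nrm: "P.nrm (embed \<xi>) = hnorm H \<xi>" if "\<xi> \<in> carrier H" for \<xi>
    using that by (simp add: embed_def P.nrm_def hnorm_def P.ip_kernel P.dil_kernel_def embed_simps
        E.channel_kernel_UNIV_left F.channel_kernel_UNIV_left)
  show ?thesis
    unfolding isometry_op_def bounded_op_def
    by (auto simp: mem nrm P.rkhs_add P.hnorm_rkhs P.clip_id fun_eq_iff val[OF _ refl refl]
        E.lin_op_add E.lin_op_smult E.hinner_add_left E.hinner_smult_left
        intro!: exI[of _ 1])
qed

text \<open>The two projections replace the letters of the index of V \<xi>. The inner product of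
  the result with V \<eta> is, by the reproducing property, a value of the kernel.\<close>

lemma compress_lift_proj:
  assumes "\<alpha> \<in> sets borel" "\<beta> \<in> sets borel" "\<xi> \<in> carrier H"
  shows "adjoint_op H P.rkhs embed (P.lift (P.proj x \<alpha>) (P.lift (Q.proj y \<beta>) (embed \<xi>))) = E x \<alpha> (F y \<beta> \<xi>)"
proof -
  let ?s = "\<lambda>\<xi>. ([Inl (undefined, UNIV), Inr (undefined, UNIV)], \<xi>) :: ('x, 'a, 'y, 'b, 'h) word"
  let ?t = "set_first (x, \<alpha>) \<xi> (set_second (y, \<beta>) \<xi> (?s \<xi>))"
  have "P.lift (Q.proj y \<beta>) (embed \<xi>) = P.dil_kernel (set_second (y, \<beta>) \<xi> (?s \<xi>))"
    using Q.lift_proj_kernel_UNIV[of \<beta> "?s \<xi>" y] assms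
    by (simp add: embed_def dil_kernels_eq embed_simps)
  moreover have "P.lift (P.proj x \<alpha>) (P.dil_kernel (set_second (y, \<beta>) \<xi> (?s \<xi>))) = P.dil_kernel ?t"
    using P.lift_proj_kernel_UNIV[of \<alpha> "set_second (y, \<beta>) \<xi> (?s \<xi>)" x] assms
    by (simp add: embed_simps)
  ultimately have img: "P.lift (P.proj x \<alpha>) (P.lift (Q.proj y \<beta>) (embed \<xi>)) = P.dil_kernel ?t" by simp
  have closed: "E x \<alpha> (F y \<beta> \<xi>) \<in> carrier H" using assms by simp
  have inner: "hinner P.rkhs (P.dil_kernel ?t) (embed \<eta>) = hinner H (E x \<alpha> (F y \<beta> \<xi>)) \<eta>" if "\<eta> \<in> carrier H" for \<eta>
    using that assms by (simp add: embed_def P.rkhs_hinner P.ip_kernel P.dil_kernel_def embed_simps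
        E.channel_kernel_UNIV_right F.channel_kernel_UNIV_right)
  show ?thesis
    unfolding adjoint_op_def img
    using closed inner by (intro the_equality) (auto intro!: E.hinner_eqI)
qed

end

lemma borel_probability_points:
  fixes \<mu> :: "'x::t2_space measure"
  assumes "borel_probability \<mu>"
  shows "{x} \<in> sets (completion \<mu>)"
  using assms by (intro sets_completionI_sets) (simp add: borel_probability_def)

theorem corollary4p5:
  fixes \<mu> :: "'x::{second_countable_topology, t2_space} measure"
    and \<nu> :: "'y::{second_countable_topology, t2_space} measure"
    and H :: "'h hilbert"
    and E :: "'x \<Rightarrow> 'a::{second_countable_topology, t2_space} set \<Rightarrow> 'h \<Rightarrow> 'h"
    and F :: "'y \<Rightarrow> 'b::{second_countable_topology, t2_space} set \<Rightarrow> 'h \<Rightarrow> 'h"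
  assumes "compact (UNIV :: 'x set)" and "compact (UNIV :: 'y set)"
    and "compact (UNIV :: 'a set)" and "compact (UNIV :: 'b set)"
    and "hilbert_space H"
    and "borel_probability \<mu>" and "nonatomic \<mu>"
    and "borel_probability \<nu>" and "nonatomic \<nu>"
    and "information_channel H \<mu> E"
    and "information_channel H \<nu> F"
    and "commuting_ranges H E F"
  shows "\<exists>(K :: ('x, 'a, 'y, 'b, 'h) dilation_vector hilbert) V P Q.
    hilbert_space K \<and>
    isometry_op H K V \<and>
    information_channel K \<mu> P \<and>
    information_channel K \<nu> Q \<and>
    commuting_ranges K P Q \<and>
    projection_valued K P \<and>
    projection_valued K Q \<and>
    (\<forall>x y. \<forall>\<alpha>\<in>sets borel. \<forall>\<beta>\<in>sets borel. \<forall>\<xi>\<in>carrier H.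
       E x \<alpha> (F y \<beta> \<xi>) = adjoint_op H K V (P x \<alpha> (Q y \<beta> (V \<xi>))))"
proof -
  interpret hilbert_space H by fact
  interpret commuting_channels H E F
    by unfold_locales (use assms in \<open>auto simp: information_channel_def commuting_ranges_def\<close>)
  define P where "P x \<alpha> = P.lift (P.proj x \<alpha>)" for x \<alpha>
  define Q where "Q y \<beta> = P.lift (Q.proj y \<beta>)" for y \<beta>
  \<comment> \<open>\<open>lift\<close> does not depend on the kernel; only the spaces of the two
    instances have to be identified.\<close>
  have rkhs_eq: "Q.rkhs = P.rkhs" and kspace_eq: "Q.kspace = P.kspace" by (simp_all add: dil_kernels_eq)
  have "information_channel P.rkhs \<mu> P"
    unfolding information_channel_def P_def
    using assms by (auto simp: information_channel_def P.qpm_lift_proj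
        intro!: P.hinner_lift_proj_measurable borel_probability_points)
  moreover have "information_channel P.rkhs \<nu> Q"
    unfolding information_channel_def Q_def rkhs_eq[symmetric]
    using assms by (auto simp: information_channel_def Q.qpm_lift_proj
        intro!: Q.hinner_lift_proj_measurable borel_probability_points)
  moreover have "commuting_ranges P.rkhs P Q"
    by (simp add: commuting_ranges_def P_def Q_def lift_proj_commute)
  moreover have "projection_valued P.rkhs P"
    by (simp add: projection_valued_def P_def P.projection_op_lift P.symmetric_idem_proj)
  moreover have "projection_valued P.rkhs Q"
    unfolding rkhs_eq[symmetric]
    by (simp add: projection_valued_def Q_def Q.projection_op_lift Q.symmetric_idem_proj)
  moreover have "E x \<alpha> (F y \<beta> \<xi>) = adjoint_op H P.rkhs embed (P x \<alpha> (Q y \<beta> (embed \<xi>)))"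
    if "\<alpha> \<in> sets borel" "\<beta> \<in> sets borel" "\<xi> \<in> carrier H" for x y \<alpha> \<beta> \<xi>
    using compress_lift_proj[OF that] by (simp add: P_def Q_def)
  ultimately show ?thesis
    using P.hilbert_space_rkhs isometry_embed by blast
qed

end
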